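(* Let $n\ge1$ be an integer and $1\le p\le\infty$. Assume that $\psi\in H_n^\infty(\mathbb C^+)$ or $\psi\in H_n^p(\mathbb C^+)$, and that $\varphi$ is a holomorphic self-map of $\mathbb C^+$ such that $\varphi'\in H_{n-1}^\infty(\mathbb C^+)$ and the function $$A_\varphi(z,w)=\bigl|\operatorname{Re}(\varphi'(z))+i\operatorname{Im}(\varphi'(w))\bigr|,\qquad z,w\in\mathbb C^+,$$ has a positive lower bound on $\mathbb C^+\times\mathbb C^+$. Then the weighted composition operator $T_{\psi,\varphi}F=\psi\cdot(F\circ\varphi)$ is bounded on $H_n^p(\mathbb C^+)$.
   Context: $\mathbb C^+=\{z\in\mathbb C:\operatorname{Im} z>0\}$. For $1\le p<\infty$, $H^p(\mathbb C^+)$ is the space of holomorphic $F$ on $\mathbb C^+$ with $\|F\|_{H^p}=\sup_{y>0}\left(\int_{\mathbb R}|F(x+iy)|^p\,dx\right)^{1/p}<\infty$; $H^\infty(\mathbb C^+)$ is the space of bounded holomorphic functions with the sup norm. For an integer $m\ge0$, $H_m^p(\mathbb C^+)$ is the Banach space of holomorphic $F$ on $\mathbb C^+$ with $F^{(k)}\in H^p(\mathbb C^+)$ for $k=0,1,\dots,m$, with norm $\|F\|_{H_m^p}=\left(\sum_{k=0}^m\|F^{(k)}\|_{H^p}^p\right)^{1/p}$ if $1\le p<\infty$ and $\|F\|_{H_m^\infty}=\sum_{k=0}^m\|F^{(k)}\|_{H^\infty}$ if $p=\infty$. *)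

theory Defs
  imports "HOL-Complex_Analysis.Complex_Analysis"
begin

text \<open>
  Functions on the upper half-plane are represented by total functions on \<open>complex\<close> whose values
  off the half-plane are irrelevant: everything below depends only on the restriction to the
  (open) half-plane.
\<close>

definition upper_half_plane :: "complex set" where
  "upper_half_plane = {z. Im z > 0}"

definition hardy_mean :: "real \<Rightarrow> (complex \<Rightarrow> complex) \<Rightarrow> real \<Rightarrow> real" where
  "hardy_mean p F y = (LINT x|lborel. cmod (F (Complex x y)) powr p) powr (1 / p)"

definition hardy_norm :: "ennreal \<Rightarrow> (complex \<Rightarrow> complex) \<Rightarrow> real" where
  "hardy_norm p F =
     (if p = \<infinity> then (SUP z\<in>upper_half_plane. cmod (F z))
      else (SUP y\<in>{0<..}. hardy_mean (enn2real p) F y))"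

text \<open>
  The integrability and boundedness conditions together say that the supremum defining the norm
  is finite; the real-valued integral and supremum alone would not detect divergence.
\<close>

definition hardy_space :: "ennreal \<Rightarrow> (complex \<Rightarrow> complex) set" where
  "hardy_space p =
     {F. F holomorphic_on upper_half_plane \<and>
         (if p = \<infinity> then bdd_above ((\<lambda>z. cmod (F z)) ` upper_half_plane)
          else (\<forall>y>0. integrable lborel (\<lambda>x. cmod (F (Complex x y)) powr enn2real p)) \<and>
               bdd_above (hardy_mean (enn2real p) F ` {0<..}))}"

definition hardy_sobolev_space :: "nat \<Rightarrow> ennreal \<Rightarrow> (complex \<Rightarrow> complex) set" where
  "hardy_sobolev_space m p =
     {F. F holomorphic_on upper_half_plane \<and> (\<forall>k\<le>m. (deriv ^^ k) F \<in> hardy_space p)}"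

definition hardy_sobolev_norm :: "nat \<Rightarrow> ennreal \<Rightarrow> (complex \<Rightarrow> complex) \<Rightarrow> real" where
  "hardy_sobolev_norm m p F =
     (if p = \<infinity> then (\<Sum>k\<le>m. hardy_norm p ((deriv ^^ k) F))
      else (\<Sum>k\<le>m. hardy_norm p ((deriv ^^ k) F) powr enn2real p) powr (1 / enn2real p))"

definition weighted_composition ::
    "(complex \<Rightarrow> complex) \<Rightarrow> (complex \<Rightarrow> complex) \<Rightarrow> (complex \<Rightarrow> complex) \<Rightarrow> complex \<Rightarrow> complex" where
  "weighted_composition \<psi> \<phi> F = (\<lambda>z. \<psi> z * F (\<phi> z))"

definition A_fun :: "(complex \<Rightarrow> complex) \<Rightarrow> complex \<Rightarrow> complex \<Rightarrow> real" where
  "A_fun \<phi> z w = cmod (complex_of_real (Re (deriv \<phi> z)) + \<i> * complex_of_real (Im (deriv \<phi> w)))"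

text \<open>
  Linearity is required only on the half-plane, where the functions are meaningful. Linearity
  together with the norm bound implies that \<open>T\<close> respects equality on the half-plane.
\<close>

definition bounded_operator_on_hardy_sobolev ::
    "nat \<Rightarrow> ennreal \<Rightarrow> ((complex \<Rightarrow> complex) \<Rightarrow> complex \<Rightarrow> complex) \<Rightarrow> bool" where
  "bounded_operator_on_hardy_sobolev m p T \<longleftrightarrow>
     (\<forall>F\<in>hardy_sobolev_space m p. T F \<in> hardy_sobolev_space m p) \<and>
     (\<forall>F\<in>hardy_sobolev_space m p. \<forall>G\<in>hardy_sobolev_space m p. \<forall>a b. \<forall>z\<in>upper_half_plane.
        T (\<lambda>u. a * F u + b * G u) z = a * T F z + b * T G z) \<and>
     (\<exists>C. \<forall>F\<in>hardy_sobolev_space m p.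
        hardy_sobolev_norm m p (T F) \<le> C * hardy_sobolev_norm m p F)"

end

theory Submission
  imports Defs "HOL-Probability.Sinc_Integral"
begin

text \<open>
  The point is that composition with \<open>\<phi>\<close> is bounded on each Hardy space; the passage to derivatives
  and the weight \<open>\<psi>\<close> are then handled by the chain and product rules.

  On the diagonal, \<open>A_fun \<phi> z z = \<bar>\<phi>' z\<bar>\<close>, so the hypothesis gives \<open>\<bar>\<phi>'\<bar> \<ge> c > 0\<close>. The Schwarz--Pick
  inequality \<open>\<bar>\<phi>' z\<bar> Im z \<le> Im (\<phi> z)\<close> turns this into \<open>Im (\<phi> z) \<ge> c Im z\<close>
  (\<open>Schwarz_Pick_half_plane\<close>). Thus \<open>\<phi>\<close> does not compress the half-plane at infinity, and this is what
  the boundedness of the composition rests on. Namely, \<open>\<bar>F\<bar>\<^sup>p\<close> is dominated by the Poisson average of its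
  values on a lower horizontal line, so that after exchanging integrals
  \<open>\<integral> \<bar>F (\<phi> (x + i y))\<bar>\<^sup>p dx \<le> \<integral> \<bar>F (t + i \<epsilon>)\<bar>\<^sup>p (\<integral> P (\<phi> (x + i y) - i \<epsilon>, t) dx) dt\<close>.
  The inner integral is at most \<open>1 / c\<close> (\<open>nn_integral_poisson_self_map\<close>): the kernel
  \<open>P (\<phi> z - i \<epsilon>, t)\<close> is itself a positive harmonic function of \<open>z\<close>, its Poisson average over the line
  can be read off from its value at \<open>i Y\<close>, and as \<open>Y\<close> tends to infinity the lower bound on
  \<open>Im \<phi>\<close> controls that value. Taking \<open>\<epsilon>\<close> to be a fixed multiple of \<open>y\<close> keeps the whole argument
  inside the open half-plane.

  For derivatives, \<open>(F \<circ> \<phi>)' = \<phi>' \<cdot> (F' \<circ> \<phi>)\<close> reduces the order by one, and multiplication by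
  \<open>\<phi>'\<close>, or by \<open>\<psi>\<close> with bounded derivatives, is harmless by the product rule
  (\<open>sobolev_bounded_by_mult_bounded\<close>). If instead the derivatives of \<open>\<psi>\<close> lie in \<open>H\<^sup>p\<close>, a one-dimensional
  Sobolev embedding along horizontal lines (\<open>hardy_sobolev_embedding\<close>) shows that in each product at
  least one factor is bounded, so that the space is an algebra for \<open>n \<ge> 1\<close>
  (\<open>sobolev_bounded_by_mult\<close>).
\<close>

section \<open>Jensen's inequality and Cauchy's theorem on a line\<close>

lemma powr_above_tangent:
  fixes a b p :: real
  assumes "a \<ge> 0" "b \<ge> 0" "p \<ge> 1"
  shows "b powr p \<ge> a powr p + p * a powr (p - 1) * (b - a)"
proof (cases "a = 0 \<or> b = 0")
  case True
  have "a * a powr (p - 1) = a powr p" if "a > 0"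
    using that by (simp add: powr_mult_base)
  then have "b = 0 \<Longrightarrow> a > 0 \<Longrightarrow> a powr p \<le> p * a powr p"
    using assms by (simp add: mult_le_cancel_right1)
  then show ?thesis
    using True assms \<open>a > 0 \<Longrightarrow> a * a powr (p - 1) = a powr p\<close>
    by (cases "a = 0") (auto simp: algebra_simps)
next
  case False
  then have "a > 0" "b > 0" using assms by auto
  have "b powr p - a powr p \<ge> (p * a powr (p - 1)) * (b - a)"
  proof (rule convex_on_imp_above_tangent[OF powr_convex[OF \<open>p \<ge> 1\<close>]])
    show "((\<lambda>x. x powr p) has_real_derivative p * a powr (p - 1)) (at a within {0<..})"
      using \<open>a > 0\<close> by (auto intro!: derivative_eq_intros)
  qed (use \<open>a > 0\<close> \<open>b > 0\<close> in \<open>auto simp: interior_open\<close>)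
  then show ?thesis by simp
qed

text \<open>
  Jensen's inequality for \<open>t \<mapsto> t powr p\<close>, with the left side real and the right side possibly
  infinite: averages with respect to the Poisson kernel and over a window both have this form.
\<close>

lemma weighted_mean_powr_le:
  fixes k :: "'a \<Rightarrow> real" and f :: "'a \<Rightarrow> 'b::{banach, second_countable_topology}"
  assumes "p \<ge> 1" and k0: "\<And>x. k x \<ge> 0" and ik: "integrable M k" and k1: "(\<integral>x. k x \<partial>M) = 1"
    and fm [measurable]: "f \<in> borel_measurable M" and ikf: "integrable M (\<lambda>x. k x *\<^sub>R f x)"
  shows "ennreal (norm (\<integral>x. k x *\<^sub>R f x \<partial>M) powr p) \<le> (\<integral>\<^sup>+x. ennreal (k x) * ennreal (norm (f x) powr p) \<partial>M)"
proof -
  define a where "a = (\<integral>x. k x * norm (f x) \<partial>M)"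
  have [measurable]: "k \<in> borel_measurable M" using ik by auto
  have ia: "integrable M (\<lambda>x. k x * norm (f x))"
    using integrable_norm[OF ikf] k0 by simp
  have a0: "a \<ge> 0" unfolding a_def using k0 by simp
  have "norm (\<integral>x. k x *\<^sub>R f x \<partial>M) \<le> (\<integral>x. norm (k x *\<^sub>R f x) \<partial>M)"
    by (rule integral_norm_bound)
  also have "\<dots> = a" using k0 by (simp add: a_def)
  finally have le_a: "norm (\<integral>x. k x *\<^sub>R f x \<partial>M) powr p \<le> a powr p"
    using \<open>p \<ge> 1\<close> by (intro powr_mono2) auto
  have *: "(\<integral>\<^sup>+x. ennreal (k x) * ennreal (norm (f x) powr p) \<partial>M) = (\<integral>\<^sup>+x. ennreal (k x * norm (f x) powr p) \<partial>M)"
    using k0 by (simp add: ennreal_mult)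
  show ?thesis
  proof (cases "(\<integral>\<^sup>+x. ennreal (k x * norm (f x) powr p) \<partial>M) = \<infinity>")
    case False
    then have ip: "integrable M (\<lambda>x. k x * norm (f x) powr p)"
      using k0 by (intro integrableI_nonneg) (auto simp: less_top)
    \<comment> \<open>integrate the tangent line of \<open>t \<mapsto> t powr p\<close> at the mean value\<close>
    have "a powr p = (\<integral>x. a powr p * k x + p * a powr (p - 1) * (k x * norm (f x) - a * k x) \<partial>M)"
      using ik ia k1 by (simp add: a_def[symmetric])
    also have "\<dots> \<le> (\<integral>x. k x * norm (f x) powr p \<partial>M)"
    proof (rule integral_mono)
      fix x
      have "k x * (a powr p + p * a powr (p - 1) * (norm (f x) - a)) \<le> k x * norm (f x) powr p"
        using k0 a0 \<open>p \<ge> 1\<close> by (intro mult_left_mono powr_above_tangent) auto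
      then show "a powr p * k x + p * a powr (p - 1) * (k x * norm (f x) - a * k x) \<le> k x * norm (f x) powr p"
        by (simp add: algebra_simps)
    qed (use ik ia ip in auto)
    finally have "ennreal (a powr p) \<le> ennreal (\<integral>x. k x * norm (f x) powr p \<partial>M)"
      by (rule ennreal_leI)
    also have "\<dots> = (\<integral>\<^sup>+x. ennreal (k x * norm (f x) powr p) \<partial>M)"
      using ip k0 by (intro nn_integral_eq_integral[symmetric]) auto
    finally show ?thesis using le_a unfolding * by (meson ennreal_leI order_trans)
  qed (simp add: *)
qed

text \<open>
  The comparison function is a multiple of \<open>1 / (1 + t\<^sup>2)\<close>: compactness controls \<open>[-R, R]\<close>, the
  decay controls the rest.
\<close>

lemma integrable_poly_decay:
  fixes h :: "real \<Rightarrow> complex"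
  assumes c: "continuous_on UNIV h" and R: "R > 0" and B: "\<And>t. \<bar>t\<bar> \<ge> R \<Longrightarrow> cmod (h t) \<le> B / t\<^sup>2"
  shows "integrable lborel h"
proof -
  have "compact (h ` {-R..R})" using c by (intro compact_continuous_image) (auto intro: continuous_on_subset)
  then obtain K where K: "\<And>t. t \<in> {-R..R} \<Longrightarrow> cmod (h t) \<le> K"
    by (meson bounded_iff compact_imp_bounded imageI)
  have K0: "K \<ge> 0" using K[of 0] R norm_ge_zero[of "h 0"] by (simp del: norm_ge_zero)
  have B0: "B \<ge> 0" using B[of R] R norm_ge_zero[of "h R"]
    by (smt (verit) divide_neg_pos zero_less_power)
  define L where "L = K * (1 + R\<^sup>2) + B * (1 + 1 / R\<^sup>2)"
  have bd: "cmod (h t) \<le> L * inverse (1 + t\<^sup>2)" for t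
  proof (cases "\<bar>t\<bar> \<le> R")
    case True
    then have "t\<^sup>2 \<le> R\<^sup>2" using R by (simp add: abs_le_square_iff[symmetric])
    have "cmod (h t) * (1 + t\<^sup>2) \<le> K * (1 + R\<^sup>2)"
      using K[of t] True K0 \<open>t\<^sup>2 \<le> R\<^sup>2\<close> by (intro mult_mono) (auto simp: abs_le_iff)
    also have "\<dots> \<le> L" unfolding L_def using B0 by simp
    finally show ?thesis by (simp add: field_simps add_pos_nonneg)
  next
    case False
    then have t: "\<bar>t\<bar> \<ge> R" "t \<noteq> 0" using R by auto
    have "R\<^sup>2 \<le> t\<^sup>2" using t R by (simp add: abs_le_square_iff[symmetric])
    then have "1 / t\<^sup>2 \<le> 1 / R\<^sup>2" using R t by (intro divide_left_mono) auto
    have "cmod (h t) * (1 + t\<^sup>2) \<le> B / t\<^sup>2 * (1 + t\<^sup>2)"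
      using B[OF t(1)] by (intro mult_right_mono) auto
    also have "\<dots> = B * (1 + 1 / t\<^sup>2)" using t by (simp add: field_simps)
    also have "\<dots> \<le> B * (1 + 1 / R\<^sup>2)" using B0 \<open>1 / t\<^sup>2 \<le> 1 / R\<^sup>2\<close> by (intro mult_left_mono) auto
    also have "\<dots> \<le> L" unfolding L_def using K0 by simp
    finally show ?thesis by (simp add: field_simps add_pos_nonneg)
  qed
  have "integrable lborel (\<lambda>t::real. inverse (1 + t\<^sup>2))"
    using integrable_inverse_1_plus_square by (simp add: set_integrable_def)
  then have "integrable lborel (\<lambda>t. L * inverse (1 + t\<^sup>2))" by simp
  then show ?thesis
  proof (rule Bochner_Integration.integrable_bound)
    show "h \<in> borel_measurable lborel" using c borel_measurable_continuous_onI by auto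
    show "AE x in lborel. norm (h x) \<le> norm (L * inverse (1 + x\<^sup>2))"
      using bd by (intro AE_I2) (metis abs_ge_self order_trans real_norm_def)
  qed
qed

text \<open>
  Integrate over the boundary of the upper half-disc of radius \<open>R\<close>. The quadratic decay makes the
  arc contribute \<open>O(1 / R)\<close>, so only the integral over the line survives as \<open>R\<close> grows. The strip
  below the axis makes the closed half-disc lie in an open convex domain.
\<close>

lemma Cauchy_theorem_real_line:
  assumes hol: "g holomorphic_on {z. Im z > -d}" and d: "d > 0" and R0: "R0 > 0"
    and B: "\<And>z. Im z \<ge> 0 \<Longrightarrow> cmod z \<ge> R0 \<Longrightarrow> cmod (g z) \<le> B / (cmod z)\<^sup>2"
  shows "integrable lborel (\<lambda>t. g (of_real t))" and "(LINT t|lborel. g (of_real t)) = 0"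
proof -
  have cont: "continuous_on UNIV (\<lambda>t::real. g (of_real t))"
    by (rule continuous_on_compose2[OF holomorphic_on_imp_continuous_on[OF hol]])
       (use d in \<open>auto intro!: continuous_intros\<close>)
  show int: "integrable lborel (\<lambda>t. g (of_real t))"
    by (rule integrable_poly_decay[OF cont R0, of B]) (use B[of "of_real _"] in auto)
  have bound: "cmod (LINT t|lborel. indicator {-R..R} t *\<^sub>R g (of_real t)) \<le> B * pi / R" if R: "R \<ge> R0" for R
  proof -
    have R': "R > 0" using R R0 by simp
    define I where "I = (LINT t|lborel. indicator {-R..R} t *\<^sub>R g (of_real t))"
    have "set_integrable lborel {-R..R} (\<lambda>t. g (of_real t))"
      using int unfolding set_integrable_def by (intro integrable_mult_indicator) auto
    then have "((\<lambda>t. g (of_real t)) has_integral I) {-R..R}"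
      using set_borel_integral_eq_integral[of "{-R..R}" "\<lambda>t. g (of_real t)"]
      unfolding I_def set_lebesgue_integral_def by (simp add: has_integral_integral)
    then have seg: "(g has_contour_integral I) (linepath (of_real (-R)) (of_real R))"
      using R' by (subst has_contour_integral_linepath_Reals_iff) auto
    let ?S = "{z. Im z > -d}"
    have sub: "Im z \<ge> 0 \<and> cmod z = R" if "z \<in> path_image (part_circlepath 0 R 0 pi)" for z
      using that R' by (auto simp: path_image_part_circlepath' closed_segment_eq_real_ivl norm_mult intro!: mult_nonneg_nonneg sin_ge_zero)
    have arc_cont: "continuous_on (path_image (part_circlepath 0 R 0 pi)) g"
      using sub d by (intro continuous_on_subset[OF holomorphic_on_imp_continuous_on[OF hol]]) fastforce
    then obtain J where J: "(g has_contour_integral J) (part_circlepath 0 R 0 pi)"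
      using contour_integrable_continuous_part_circlepath contour_integrable_on_def by blast
    let ?\<gamma> = "linepath (of_real (-R)) (of_real R) +++ part_circlepath 0 R 0 pi"
    have fin: "pathfinish (linepath (of_real (-R)) (of_real R)) = pathstart (part_circlepath 0 R 0 pi)" by simp
    have "(g has_contour_integral (I + J)) ?\<gamma>"
      by (rule has_contour_integral_join[OF seg J]) auto
    moreover have "(g has_contour_integral 0) ?\<gamma>"
    proof (rule Cauchy_theorem_convex_simple[OF hol])
      have "path_image ?\<gamma> \<subseteq> path_image (linepath (of_real (-R)) (of_real R)) \<union> path_image (part_circlepath 0 R 0 pi)"
        by (rule path_image_join_subset)
      also have "\<dots> \<subseteq> ?S"
        using sub d by (fastforce simp: closed_segment_def)
      finally show "path_image ?\<gamma> \<subseteq> ?S" .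
      show "valid_path ?\<gamma>" by (intro valid_path_join) auto
    qed (auto simp: convex_halfspace_Im_gt)
    ultimately have "I + J = 0" by (metis contour_integral_unique)
    moreover have "cmod J \<le> B / R\<^sup>2 * R * (pi - 0)"
    proof (rule has_contour_integral_bound_part_circlepath[OF J])
      show "0 \<le> B / R\<^sup>2"
        using B[of "of_real R"] R R' norm_ge_zero[of "g (of_real R)"] by (auto simp del: norm_ge_zero)
      show "cmod (g z) \<le> B / R\<^sup>2" if "z \<in> path_image (part_circlepath 0 R 0 pi)" for z
        using B[of z] sub[OF that] R by simp
    qed (use R' in auto)
    ultimately show ?thesis using R' unfolding I_def[symmetric]
      by (simp add: power2_eq_square add_eq_0_iff2)
  qed
  have "(\<lambda>n::nat. LINT t|lborel. indicator {-real n..real n} t *\<^sub>R g (of_real t)) \<longlonglongrightarrow> (LINT t|lborel. g (of_real t))"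
  proof (rule integral_dominated_convergence[where w="\<lambda>t. cmod (g (of_real t))"])
    show "AE t in lborel. (\<lambda>n::nat. indicator {-real n..real n} t *\<^sub>R g (of_real t)) \<longlonglongrightarrow> g (of_real t)"
    proof (intro AE_I2 tendsto_eventually)
      fix t :: real
      show "\<forall>\<^sub>F n in sequentially. indicator {-real n..real n} t *\<^sub>R g (of_real t) = g (of_real t)"
        using eventually_ge_at_top[of "nat \<lceil>\<bar>t\<bar>\<rceil>"]
        by eventually_elim (auto simp: indicator_def nat_ceiling_le_eq)
    qed
  qed (use int in \<open>auto simp: indicator_def intro!: integrable_norm\<close>)
  moreover have "(\<lambda>n::nat. LINT t|lborel. indicator {-real n..real n} t *\<^sub>R g (of_real t)) \<longlonglongrightarrow> 0"
  proof (rule Lim_null_comparison)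
    show "\<forall>\<^sub>F n in sequentially. norm (LINT t|lborel. indicator {-real n..real n} t *\<^sub>R g (of_real t)) \<le> B * pi / real n"
      using eventually_ge_at_top[of "nat \<lceil>R0\<rceil>"]
      by eventually_elim (use bound in \<open>auto simp: nat_ceiling_le_eq\<close>)
    show "(\<lambda>n. B * pi / real n) \<longlonglongrightarrow> 0" by (rule lim_const_over_n)
  qed
  ultimately show "(LINT t|lborel. g (of_real t)) = 0" using LIMSEQ_unique by blast
qed

section \<open>The Poisson formula and the Schwarz--Pick inequality\<close>

definition poisson :: "complex \<Rightarrow> real \<Rightarrow> real" where
  "poisson w t = Im w / (pi * (cmod (w - of_real t))\<^sup>2)"

lemma poisson_nonneg: "Im w \<ge> 0 \<Longrightarrow> poisson w t \<ge> 0"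
  by (simp add: poisson_def)

lemma poisson_eq: "poisson w t = Im w / (pi * ((t - Re w)\<^sup>2 + (Im w)\<^sup>2))"
  by (simp add: poisson_def cmod_power2 power2_commute)

text \<open>
  The same kernel is, in its interior argument, the imaginary part of a holomorphic function. This
  is what allows the Poisson formula to be applied to the kernel itself.
\<close>

lemma Im_neg_inverse_eq_poisson: "Im (- 1 / (w - of_real t)) = pi * poisson w t"
  by (simp add: poisson_def Im_divide cmod_power2)

text \<open>
  An affine substitution turns the kernel into the Cauchy density \<open>1 / (\<pi> (1 + t\<^sup>2))\<close>.
\<close>

lemma integrable_poisson: "Im w > 0 \<Longrightarrow> integrable lborel (poisson w)"
  and integral_poisson: "Im w > 0 \<Longrightarrow> (LINT t|lborel. poisson w t) = 1"
proof -
  assume w: "Im w > 0"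
  let ?q = "\<lambda>t::real. inverse (1 + t\<^sup>2)"
  have iq: "integrable lborel ?q"
    using integrable_inverse_1_plus_square by (simp add: set_integrable_def)
  have vq: "(LINT t|lborel. ?q t) = pi"
    using LBINT_inverse_1_plus_square by (simp add: interval_lebesgue_integral_def set_lebesgue_integral_def)
  have eq: "?q (- Re w / Im w + (1 / Im w) * t) = pi * Im w * poisson w t" for t
  proof -
    have "- Re w / Im w + (1 / Im w) * t = (t - Re w) / Im w"
      using w by (simp add: field_simps)
    moreover have "1 + ((t - Re w) / Im w)\<^sup>2 = ((t - Re w)\<^sup>2 + (Im w)\<^sup>2) / (Im w)\<^sup>2"
      using w by (simp add: field_simps)
    ultimately show ?thesis
      using w by (simp add: poisson_eq power2_eq_square)
  qed
  have "integrable lborel (\<lambda>t. ?q (- Re w / Im w + (1 / Im w) * t))"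
    by (rule lborel_integrable_real_affine[OF iq]) (use w in auto)
  then have "integrable lborel (\<lambda>t. (pi * Im w) * poisson w t)" unfolding eq .
  then show "integrable lborel (poisson w)"
    using w by (subst (asm) integrable_mult_left_iff) auto
  have "pi = \<bar>1 / Im w\<bar> *\<^sub>R (LINT t|lborel. ?q (- Re w / Im w + (1 / Im w) * t))"
    unfolding vq[symmetric] by (rule lborel_integral_real_affine) (use w in auto)
  also have "\<dots> = pi * (LINT t|lborel. poisson w t)"
    unfolding eq using w by simp
  finally show "(LINT t|lborel. poisson w t) = 1" by simp
qed

text \<open>
  The difference quotient of \<open>f\<close> at \<open>w\<close>, divided by \<open>z - cnj w\<close>, has no pole in the upper
  half-plane and decays quadratically, so Cauchy's theorem on the line applies to it. For real \<open>t\<close> one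
  has \<open>(t - w) (t - cnj w) = \<bar>w - t\<bar>\<^sup>2\<close>, hence the vanishing integral is, up to a constant, the Poisson
  average of \<open>f - f w\<close>.
\<close>

lemma poisson_representation:
  assumes hol: "f holomorphic_on {z. Im z > -d}" and d: "d > 0"
    and B: "\<And>z. Im z \<ge> 0 \<Longrightarrow> cmod (f z) \<le> B" and w: "Im w > 0"
  shows "integrable lborel (\<lambda>t. poisson w t *\<^sub>R f (of_real t))"
    and "(LINT t|lborel. poisson w t *\<^sub>R f (of_real t)) = f w"
proof -
  define q where "q = (\<lambda>z. if z = w then deriv f w else (f z - f w) / (z - w))"
  define g where "g = (\<lambda>z. q z / (z - cnj w))"
  \<comment> \<open>the strip must also avoid the pole at \<open>cnj w\<close>\<close>
  define e where "e = min d (Im w)"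
  have e: "e > 0" using d w by (simp add: e_def)
  have q: "q holomorphic_on {z. Im z > -d}"
    unfolding q_def by (rule pole_lemma_open[OF hol]) (simp add: open_halfspace_Im_gt)
  have "g holomorphic_on {z. Im z > -e}"
    unfolding g_def
    by (intro holomorphic_intros holomorphic_on_subset[OF q]) (auto simp: e_def)
  have B0: "B \<ge> 0" using B[of 0] norm_ge_zero[of "f 0"] by (simp del: norm_ge_zero)
  have decay: "cmod (g z) \<le> (8 * B) / (cmod z)\<^sup>2" if z: "Im z \<ge> 0" "cmod z \<ge> 2 * cmod w" for z
  proof -
    have "w \<noteq> 0" using w by auto
    then have z0: "cmod z > 0" using z(2) by (smt (verit) zero_less_norm_iff)
    have 1: "cmod (z - w) \<ge> cmod z / 2" "cmod (z - cnj w) \<ge> cmod z / 2"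
      using norm_triangle_ineq2[of z w] norm_triangle_ineq2[of z "cnj w"] z(2) by auto
    then have "z \<noteq> w" using z0 by auto
    have "cmod (f z - f w) \<le> 2 * B"
      using B[of z] B[of w] z(1) w norm_triangle_ineq4[of "f z" "f w"] by simp
    moreover have "cmod (z - w) * cmod (z - cnj w) \<ge> (cmod z / 2) * (cmod z / 2)"
      using 1 z0 by (intro mult_mono) auto
    ultimately have "cmod (f z - f w) / (cmod (z - w) * cmod (z - cnj w)) \<le> (2 * B) / ((cmod z / 2) * (cmod z / 2))"
      using z0 B0 by (intro frac_le) auto
    then show ?thesis
      using \<open>z \<noteq> w\<close> by (simp add: g_def q_def norm_divide norm_mult power2_eq_square)
  qed
  have R: "2 * cmod w > 0" using w by auto
  have C: "integrable lborel (\<lambda>t. g (of_real t))" "(LINT t|lborel. g (of_real t)) = 0"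
    using Cauchy_theorem_real_line[OF \<open>g holomorphic_on {z. Im z > -e}\<close> e R] decay by blast+
  have kernel: "poisson w t *\<^sub>R (f (of_real t) - f w) = (Im w / pi) *\<^sub>R g (of_real t)" for t
  proof -
    have ne: "of_real t \<noteq> w" "of_real t \<noteq> cnj w" using w by (auto simp: complex_eq_iff)
    have "(of_real t - w) * (of_real t - cnj w) = of_real ((cmod (w - of_real t))\<^sup>2)"
      using complex_norm_square[of "w - of_real t"] by (simp add: algebra_simps)
    then show ?thesis
      using ne w by (simp add: g_def q_def poisson_def scaleR_conv_of_real field_simps)
  qed
  have i1: "integrable lborel (\<lambda>t. poisson w t *\<^sub>R (f (of_real t) - f w))"
    unfolding kernel by (rule integrable_scaleR_right[OF C(1)])
  have v1: "(LINT t|lborel. poisson w t *\<^sub>R (f (of_real t) - f w)) = 0"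
    unfolding kernel integral_scaleR_right C(2) by simp
  have i2: "integrable lborel (\<lambda>t. poisson w t *\<^sub>R f w)"
    using integrable_poisson[OF w] by (intro integrable_scaleR_left)
  have split: "poisson w t *\<^sub>R f (of_real t) = poisson w t *\<^sub>R (f (of_real t) - f w) + poisson w t *\<^sub>R f w" for t
    by (simp add: algebra_simps)
  show "integrable lborel (\<lambda>t. poisson w t *\<^sub>R f (of_real t))"
    unfolding split using i1 i2 by auto
  show "(LINT t|lborel. poisson w t *\<^sub>R f (of_real t)) = f w"
    unfolding split using i1 i2 v1 integral_poisson[OF w] integrable_poisson[OF w] by simp
qed

text \<open>
  The Schwarz--Pick inequality: transport \<open>\<phi>\<close> to a self-map of the disc fixing \<open>0\<close> by Cayley
  transforms centred at \<open>z0\<close> and at \<open>\<phi> z0\<close>, and apply the Schwarz lemma to its derivative at \<open>0\<close>.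
\<close>

lemma Schwarz_Pick_half_plane:
  assumes hol: "\<phi> holomorphic_on upper_half_plane" and self: "\<phi> ` upper_half_plane \<subseteq> upper_half_plane"
    and z0: "z0 \<in> upper_half_plane"
  shows "cmod (deriv \<phi> z0) * Im z0 \<le> Im (\<phi> z0)"
proof -
  define b where "b = \<phi> z0"
  have a: "Im z0 > 0" and b: "Im b > 0"
    using z0 self by (auto simp: upper_half_plane_def b_def)
  define S where "S = (\<lambda>\<zeta>. (z0 - cnj z0 * \<zeta>) / (1 - \<zeta>))"
  define T where "T = (\<lambda>w. (w - b) / (w - cnj b))"
  have S_UHP: "S \<zeta> \<in> upper_half_plane" if "cmod \<zeta> < 1" for \<zeta>
  proof -
    have ne: "1 - \<zeta> \<noteq> 0" using that by auto
    have "Im (S \<zeta>) = Im ((z0 - cnj z0 * \<zeta>) * cnj (1 - \<zeta>)) / (cmod (1 - \<zeta>))\<^sup>2"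
      unfolding S_def Im_divide' by simp
    also have "Im ((z0 - cnj z0 * \<zeta>) * cnj (1 - \<zeta>)) = Im z0 * (1 - (cmod \<zeta>)\<^sup>2)"
      unfolding cmod_power2 by (simp add: algebra_simps power2_eq_square)
    finally show ?thesis using a ne that
      by (simp add: upper_half_plane_def abs_square_less_1)
  qed
  have T_disc: "cmod (T w) < 1" and T_ne: "w - cnj b \<noteq> 0" if "w \<in> upper_half_plane" for w
  proof -
    have w: "Im w > 0" using that by (simp add: upper_half_plane_def)
    show ne: "w - cnj b \<noteq> 0" using w b by (auto simp: complex_eq_iff)
    have "(cmod (w - b))\<^sup>2 < (cmod (w - cnj b))\<^sup>2"
      using mult_pos_pos[OF w b] unfolding cmod_power2 by (simp add: power2_eq_square algebra_simps)
    then have "cmod (w - b) < cmod (w - cnj b)" by (rule power2_less_imp_less) simp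
    then show "cmod (T w) < 1" using ne by (simp add: T_def norm_divide)
  qed
  have S0: "S 0 = z0" by (simp add: S_def)
  define h where "h = (\<lambda>\<zeta>. T (\<phi> (S \<zeta>)))"
  have holS: "S holomorphic_on ball 0 1"
    unfolding S_def by (intro holomorphic_intros) auto
  have hol1: "(\<phi> \<circ> S) holomorphic_on ball 0 1"
    by (rule holomorphic_on_compose_gen[OF holS hol]) (use S_UHP in auto)
  have holT: "T holomorphic_on upper_half_plane"
    unfolding T_def by (intro holomorphic_intros) (use T_ne in auto)
  have "(T \<circ> (\<phi> \<circ> S)) holomorphic_on ball 0 1"
    by (rule holomorphic_on_compose_gen[OF hol1 holT]) (use S_UHP self in auto)
  then have holh: "h holomorphic_on ball 0 1" by (simp add: h_def o_def)
  have "norm (deriv h 0) \<le> 1"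
  proof (rule Schwarz_Lemma(2)[OF holh, of 0])
    show "h 0 = 0" by (simp add: h_def S0 T_def b_def)
    show "norm (h \<zeta>) < 1" if "norm \<zeta> < 1" for \<zeta>
      unfolding h_def using S_UHP[OF that] self by (intro T_disc) auto
  qed simp
  have dS: "(S has_field_derivative (z0 - cnj z0)) (at 0)"
    unfolding S_def by (rule derivative_eq_intros refl | simp)+
  have dphi: "(\<phi> has_field_derivative deriv \<phi> z0) (at (S 0))"
    unfolding S0 using holomorphic_derivI[OF hol _ z0]
    by (simp add: upper_half_plane_def open_halfspace_Im_gt)
  have bne: "b - cnj b \<noteq> 0" using b by (auto simp: complex_eq_iff)
  have dT: "(T has_field_derivative 1 / (b - cnj b)) (at (\<phi> (S 0)))"
    unfolding T_def S0 b_def[symmetric] using bne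
    by (auto intro!: derivative_eq_intros)
  have "((\<lambda>\<zeta>. \<phi> (S \<zeta>)) has_field_derivative deriv \<phi> z0 * (z0 - cnj z0)) (at 0)"
    by (rule DERIV_chain2[where g = S, OF dphi dS])
  then have "(h has_field_derivative (1 / (b - cnj b)) * (deriv \<phi> z0 * (z0 - cnj z0))) (at 0)"
    unfolding h_def by (rule DERIV_chain2[where f = T and g = "\<lambda>\<zeta>. \<phi> (S \<zeta>)", OF dT])
  then have "cmod ((1 / (b - cnj b)) * (deriv \<phi> z0 * (z0 - cnj z0))) \<le> 1"
    using \<open>norm (deriv h 0) \<le> 1\<close> DERIV_imp_deriv by metis
  moreover have "cmod (b - cnj b) = 2 * Im b" "cmod (z0 - cnj z0) = 2 * Im z0"
    using a b by (auto simp: complex_diff_cnj norm_mult)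
  ultimately have "cmod (deriv \<phi> z0) * (2 * Im z0) / (2 * Im b) \<le> 1"
    by (simp add: norm_mult norm_divide del: right_diff_distrib)
  then show ?thesis
    using b by (simp add: b_def[symmetric])
qed

section \<open>Composition with bounded functions\<close>

lemma upper_half_plane_open_convex [simp]: "open upper_half_plane" "convex upper_half_plane"
  by (auto simp: upper_half_plane_def open_halfspace_Im_gt convex_halfspace_Im_gt)

lemma Complex_in_upper_half_plane [simp]: "Complex x y \<in> upper_half_plane \<longleftrightarrow> y > 0"
  by (simp add: upper_half_plane_def)

lemma continuous_on_horizontal_line:
  assumes "F holomorphic_on upper_half_plane" "y > 0"
  shows "continuous_on UNIV (\<lambda>x. F (Complex x y))"
  by (rule continuous_on_compose2[OF holomorphic_on_imp_continuous_on[OF assms(1)]])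
     (use assms(2) in \<open>auto simp: Complex_eq upper_half_plane_def intro!: continuous_intros\<close>)

lemma borel_measurable_horizontal_line:
  assumes "F holomorphic_on upper_half_plane" "y > 0"
  shows "(\<lambda>x. F (Complex x y)) \<in> borel_measurable borel"
  by (rule borel_measurable_continuous_onI[OF continuous_on_horizontal_line[OF assms]])

text \<open>
  As a function of \<open>z\<close>, the kernel at \<open>\<phi> z\<close> is the imaginary part of a bounded holomorphic function
  divided by \<open>\<pi>\<close>. Hence its Poisson average along the line at height \<open>y\<close>, taken with respect to the
  point at height \<open>Y\<close> above that line, equals its value there, which is at most \<open>1 / (\<pi> c Y)\<close> because
  \<open>Im (\<phi> z) \<ge> c Im z\<close>. Multiplied by \<open>\<pi> Y\<close>, the averaging weight \<open>Y / (\<pi> (x\<^sup>2 + Y\<^sup>2))\<close> tends to \<open>1\<close>,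
  and Fatou's lemma gives the bound.

  The boundary is the line at height \<open>c y / 4\<close>: since \<open>\<phi>\<close> maps everything above height \<open>y / 2\<close> to
  height at least \<open>c y / 2\<close>, the image stays away from it.
\<close>

lemma nn_integral_poisson_self_map:
  assumes hol: "\<phi> holomorphic_on upper_half_plane" and c: "c > 0"
    and low: "\<And>z. z \<in> upper_half_plane \<Longrightarrow> c * Im z \<le> Im (\<phi> z)" and y: "y > 0"
  shows "(\<integral>\<^sup>+x. ennreal (poisson (\<phi> (Complex x y) - \<i> * of_real (c * y / 4)) t) \<partial>lborel) \<le> ennreal (1 / c)"
proof -
  define s where "s = of_real t + \<i> * of_real (c * y / 4)"
  define f where "f = (\<lambda>z. - 1 / (\<phi> (z + \<i> * of_real y) - s))"
  define u where "u = (\<lambda>x. poisson (\<phi> (Complex x y) - \<i> * of_real (c * y / 4)) t)"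
  have im: "c * (Im z + 3 * y / 4) \<le> Im (\<phi> (z + \<i> * of_real y) - s)" if "Im z > - (y / 2)" for z
    using low[of "z + \<i> * of_real y"] that y by (simp add: upper_half_plane_def s_def algebra_simps)
  have pos: "Im (\<phi> (z + \<i> * of_real y) - s) > 0" if "Im z > - (y / 2)" for z
  proof -
    have "c * (Im z + 3 * y / 4) > 0" using that c y by (intro mult_pos_pos) auto
    then show ?thesis using im[OF that] by linarith
  qed
  have "((\<lambda>z. \<phi> (z + \<i> * of_real y))) holomorphic_on {z. Im z > - (y / 2)}"
    by (rule holomorphic_on_compose_gen[OF _ hol, unfolded o_def])
       (use y in \<open>auto intro!: holomorphic_intros simp: upper_half_plane_def\<close>)
  then have holf: "f holomorphic_on {z. Im z > - (y / 2)}"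
    unfolding f_def using pos by (intro holomorphic_intros) force+
  have norm_f: "cmod (f z) \<le> 1 / (c * (Im z + 3 * y / 4))" if "Im z \<ge> 0" for z
  proof -
    have p: "c * (Im z + 3 * y / 4) > 0" using that c y by (intro mult_pos_pos) auto
    have "c * (Im z + 3 * y / 4) \<le> cmod (\<phi> (z + \<i> * of_real y) - s)"
      using im[of z] that y abs_Im_le_cmod[of "\<phi> (z + \<i> * of_real y) - s"] by linarith
    then show ?thesis using p by (simp add: f_def norm_divide frac_le)
  qed
  have B: "cmod (f z) \<le> 1 / (c * (3 * y / 4))" if "Im z \<ge> 0" for z
  proof -
    have "1 / (c * (Im z + 3 * y / 4)) \<le> 1 / (c * (3 * y / 4))"
      using that c y by (intro divide_left_mono mult_left_mono mult_pos_pos) auto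
    then show ?thesis using norm_f[OF that] by linarith
  qed
  have Im_f: "Im (f (of_real x)) = pi * u x" for x
  proof -
    have "of_real x + \<i> * of_real y = Complex x y" by (simp add: Complex_eq)
    then have "f (of_real x) = - 1 / ((\<phi> (Complex x y) - \<i> * of_real (c * y / 4)) - of_real t)"
      by (simp add: f_def s_def algebra_simps)
    then show ?thesis unfolding u_def by (simp only: Im_neg_inverse_eq_poisson)
  qed
  have u0: "u x \<ge> 0" for x
  proof -
    have "c * y \<le> Im (\<phi> (Complex x y))" using low[of "Complex x y"] y by simp
    moreover have "c * y > 0" using c y by simp
    ultimately have "Im (\<phi> (Complex x y)) \<ge> c * y / 4" by linarith
    then show ?thesis unfolding u_def by (intro poisson_nonneg) simp
  qed
  have cu: "continuous_on UNIV u"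
  proof -
    have "continuous_on UNIV (\<lambda>x::real. f (of_real x))"
      by (rule continuous_on_compose2[OF holomorphic_on_imp_continuous_on[OF holf]])
         (use y in \<open>auto intro!: continuous_intros\<close>)
    then have "continuous_on UNIV (\<lambda>x::real. Im (f (of_real x)) / pi)"
      by (intro continuous_intros) auto
    then show ?thesis unfolding Im_f by simp
  qed
  then have [measurable]: "u \<in> borel_measurable borel" by (rule borel_measurable_continuous_onI)
  \<comment> \<open>the Poisson formula at the point \<open>\<i> Y\<close>\<close>
  have weighted: "(\<integral>\<^sup>+x. ennreal (Y\<^sup>2 / (x\<^sup>2 + Y\<^sup>2) * u x) \<partial>lborel) \<le> ennreal (1 / c)" if Y: "Y > 0" for Y
  proof -
    let ?w = "\<i> * of_real Y"
    note P = poisson_representation[OF holf _ B, of ?w]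
    have i: "integrable lborel (\<lambda>x. poisson ?w x *\<^sub>R f (of_real x))"
      and v: "(LINT x|lborel. poisson ?w x *\<^sub>R f (of_real x)) = f ?w"
      using P y Y by auto
    have eq: "Im (poisson ?w x *\<^sub>R f (of_real x)) = Y / (x\<^sup>2 + Y\<^sup>2) * u x" for x
      by (simp add: Im_f poisson_eq)
    have i': "integrable lborel (\<lambda>x. Y / (x\<^sup>2 + Y\<^sup>2) * u x)"
      using integrable_Im[OF i] unfolding eq .
    have "(LINT x|lborel. Y / (x\<^sup>2 + Y\<^sup>2) * u x) = Im (f ?w)"
      using integral_Im[OF i] unfolding eq v .
    also have "\<dots> \<le> 1 / (c * (Y + 3 * y / 4))"
      using abs_Im_le_cmod[of "f ?w"] norm_f[of ?w] Y by simp
    also have "\<dots> \<le> 1 / (c * Y)"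
      using c y Y by (intro divide_left_mono mult_left_mono mult_pos_pos) auto
    finally have "Y * (LINT x|lborel. Y / (x\<^sup>2 + Y\<^sup>2) * u x) \<le> Y * (1 / (c * Y))"
      using Y by (intro mult_left_mono) auto
    then have le: "(LINT x|lborel. Y * (Y / (x\<^sup>2 + Y\<^sup>2) * u x)) \<le> 1 / c"
      using Y unfolding integral_mult_right_zero by simp
    have "(\<integral>\<^sup>+x. ennreal (Y\<^sup>2 / (x\<^sup>2 + Y\<^sup>2) * u x) \<partial>lborel) = (\<integral>\<^sup>+x. ennreal (Y * (Y / (x\<^sup>2 + Y\<^sup>2) * u x)) \<partial>lborel)"
      by (simp add: power2_eq_square mult.assoc)
    also have "\<dots> = ennreal (LINT x|lborel. Y * (Y / (x\<^sup>2 + Y\<^sup>2) * u x))"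
      using u0 Y by (intro nn_integral_eq_integral integrable_mult_right[OF i'] AE_I2) auto
    also have "\<dots> \<le> ennreal (1 / c)" using le by (rule ennreal_leI)
    finally show ?thesis .
  qed
  have lim: "(\<lambda>n. (real (Suc n))\<^sup>2 / (x\<^sup>2 + (real (Suc n))\<^sup>2) * u x) \<longlonglongrightarrow> 1 * u x" for x
  proof (intro tendsto_mult tendsto_const)
    show "(\<lambda>n. (real (Suc n))\<^sup>2 / (x\<^sup>2 + (real (Suc n))\<^sup>2)) \<longlonglongrightarrow> 1"
      by real_asymp
  qed
  have "(\<integral>\<^sup>+x. ennreal (u x) \<partial>lborel) = (\<integral>\<^sup>+x. liminf (\<lambda>n. ennreal ((real (Suc n))\<^sup>2 / (x\<^sup>2 + (real (Suc n))\<^sup>2) * u x)) \<partial>lborel)"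
    using lim by (intro nn_integral_cong lim_imp_Liminf[symmetric] tendsto_ennrealI) auto
  also have "\<dots> \<le> liminf (\<lambda>n. \<integral>\<^sup>+x. ennreal ((real (Suc n))\<^sup>2 / (x\<^sup>2 + (real (Suc n))\<^sup>2) * u x) \<partial>lborel)"
    by (rule nn_integral_liminf) measurable
  also have "\<dots> \<le> liminf (\<lambda>n. ennreal (1 / c))"
    by (intro Liminf_mono always_eventually allI weighted) auto
  also have "\<dots> = ennreal (1 / c)" by (simp add: Liminf_const)
  finally show ?thesis unfolding u_def .
qed

text \<open>
  Write \<open>F\<close> at \<open>\<phi>(x + i y)\<close> as the Poisson average of its values at height \<open>c y / 4\<close>, apply Jensen's
  inequality, and exchange the integrals: the inner one is the total mass estimated above.
  The bound on \<open>F\<close> makes the Poisson formula applicable; since the estimate is uniform in it,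
  approximation can remove it later.
\<close>

lemma nn_integral_compose_bounded:
  assumes hol: "\<phi> holomorphic_on upper_half_plane" and c: "c > 0"
    and low: "\<And>z. z \<in> upper_half_plane \<Longrightarrow> c * Im z \<le> Im (\<phi> z)" and y: "y > 0"
    and F: "F holomorphic_on upper_half_plane" and B: "\<And>z. z \<in> upper_half_plane \<Longrightarrow> cmod (F z) \<le> B"
    and p: "p \<ge> 1"
  shows "(\<integral>\<^sup>+x. ennreal (cmod (F (\<phi> (Complex x y))) powr p) \<partial>lborel)
           \<le> ennreal (1 / c) * (\<integral>\<^sup>+t. ennreal (cmod (F (Complex t (c * y / 4))) powr p) \<partial>lborel)"
proof -
  define e where "e = c * y / 4"
  have e: "e > 0" using c y by (simp add: e_def)
  define w where "w = (\<lambda>x. \<phi> (Complex x y) - \<i> * of_real e)"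
  have w: "Im (w x) > 0" for x
  proof -
    have "c * y \<le> Im (\<phi> (Complex x y))" using low[of "Complex x y"] y by simp
    moreover have "c * y > 0" using c y by simp
    ultimately have "Im (\<phi> (Complex x y)) > c * y / 4" by linarith
    then show ?thesis unfolding w_def e_def by simp
  qed
  define K where "K = (\<lambda>t. cmod (F (Complex t e)) powr p)"
  have [measurable]: "(\<lambda>t. F (Complex t e)) \<in> borel_measurable borel"
    by (rule borel_measurable_horizontal_line[OF F e])
  have [measurable]: "K \<in> borel_measurable borel" unfolding K_def by measurable
  have [measurable]: "(\<lambda>x. \<phi> (Complex x y)) \<in> borel_measurable borel"
    by (rule borel_measurable_horizontal_line[OF hol y])
  have wm [measurable]: "w \<in> borel_measurable borel" unfolding w_def by measurable
  have pm [measurable]: "(\<lambda>(x, t). poisson (w x) t) \<in> borel_measurable (borel \<Otimes>\<^sub>M borel)"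
    unfolding poisson_def by measurable
  have hol': "(\<lambda>z. F (z + \<i> * of_real e)) holomorphic_on {z. Im z > - e}"
    by (rule holomorphic_on_compose_gen[OF _ F, unfolded o_def])
       (auto intro!: holomorphic_intros simp: upper_half_plane_def)
  have point: "ennreal (cmod (F (\<phi> (Complex x y))) powr p) \<le> (\<integral>\<^sup>+t. ennreal (poisson (w x) t) * ennreal (K t) \<partial>lborel)" for x
  proof -
    have B': "cmod (F (z + \<i> * of_real e)) \<le> B" if "Im z \<ge> 0" for z
      by (rule B) (use that e in \<open>simp add: upper_half_plane_def\<close>)
    note P = poisson_representation[OF hol' e B' w[of x]]
    have eq: "of_real t + \<i> * of_real e = Complex t e" for t by (simp add: Complex_eq)
    have wx: "w x + \<i> * of_real e = \<phi> (Complex x y)" by (simp add: w_def)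
    show ?thesis
      using weighted_mean_powr_le[OF p, of "poisson (w x)" lborel "\<lambda>t. F (Complex t e)"]
        P w[of x] integrable_poisson[OF w] integral_poisson[OF w]
      unfolding eq wx K_def by (auto simp: poisson_nonneg less_imp_le)
  qed
  have "(\<integral>\<^sup>+x. ennreal (cmod (F (\<phi> (Complex x y))) powr p) \<partial>lborel)
      \<le> (\<integral>\<^sup>+x. (\<integral>\<^sup>+t. ennreal (poisson (w x) t) * ennreal (K t) \<partial>lborel) \<partial>lborel)"
    by (intro nn_integral_mono point)
  also have "\<dots> = (\<integral>\<^sup>+t. (\<integral>\<^sup>+x. ennreal (poisson (w x) t) * ennreal (K t) \<partial>lborel) \<partial>lborel)"
    by (rule lborel_pair.Fubini'[symmetric]) measurable
  also have "\<dots> = (\<integral>\<^sup>+t. (\<integral>\<^sup>+x. ennreal (poisson (w x) t) \<partial>lborel) * ennreal (K t) \<partial>lborel)"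
    by (intro nn_integral_cong nn_integral_multc) measurable
  also have "\<dots> \<le> (\<integral>\<^sup>+t. ennreal (1 / c) * ennreal (K t) \<partial>lborel)"
    unfolding w_def e_def
    by (intro nn_integral_mono mult_right_mono nn_integral_poisson_self_map[OF hol c low y]) auto
  also have "\<dots> = ennreal (1 / c) * (\<integral>\<^sup>+t. ennreal (K t) \<partial>lborel)"
    by (rule nn_integral_cmult) measurable
  finally show ?thesis unfolding K_def e_def .
qed

section \<open>Composition with functions of finite Hardy norm\<close>

text \<open>
  The Poisson formula concerns bounded functions, while a function in a Hardy space can be unbounded
  near the real axis. Averaging it over a horizontal segment of length \<open>h\<close> gives holomorphic
  approximations that are bounded on the whole half-plane.
\<close>

definition window_mean :: "real \<Rightarrow> (complex \<Rightarrow> complex) \<Rightarrow> complex \<Rightarrow> complex" where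
  "window_mean h F w = (LINT s|lborel. indicator {0..1} s *\<^sub>R F (w + of_real (h * s)))"

lemma continuous_on_window:
  assumes "F holomorphic_on upper_half_plane" "w \<in> upper_half_plane"
  shows "continuous_on A (\<lambda>s. F (w + of_real (h * s)))"
  by (rule continuous_on_compose2[OF holomorphic_on_imp_continuous_on[OF assms(1)]])
     (use assms(2) in \<open>auto simp: upper_half_plane_def intro!: continuous_intros\<close>)

lemma integrable_window:
  assumes "F holomorphic_on upper_half_plane" "w \<in> upper_half_plane"
  shows "integrable lborel (\<lambda>s. indicator {0..1} s *\<^sub>R F (w + of_real (h * s)))"
  using borel_integrable_compact[of "{0..1}" "\<lambda>s. F (w + of_real (h * s))"]
    continuous_on_window[OF assms] by (simp add: indicator_def if_distrib if_distribR
      cong: if_cong)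

lemma window_mean_powr_le:
  assumes F: "F holomorphic_on upper_half_plane" and w: "w \<in> upper_half_plane" and p: "p \<ge> 1"
  shows "ennreal (cmod (window_mean h F w) powr p)
     \<le> (\<integral>\<^sup>+s. ennreal (indicator {0..1} s) * ennreal (cmod (F (w + of_real (h * s))) powr p) \<partial>lborel)"
  unfolding window_mean_def
proof (rule weighted_mean_powr_le[OF p])
  show "integrable lborel (\<lambda>s. indicator {0..1} s *\<^sub>R F (w + of_real (h * s)))"
    by (rule integrable_window[OF F w])
  show "(\<lambda>s. F (w + of_real (h * s))) \<in> borel_measurable lborel"
    using borel_measurable_continuous_onI[OF continuous_on_window[OF F w]] by simp
qed auto

text \<open>
  By Jensen's inequality the \<open>p\<close>-th power of the average is at most \<open>1 / h\<close> times the integral of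
  \<open>\<bar>F\<bar> powr p\<close> over the whole horizontal line.
\<close>

lemma window_mean_bounded:
  assumes F: "F holomorphic_on upper_half_plane" and w: "w \<in> upper_half_plane" and p: "p \<ge> 1" and h: "h > 0"
    and M: "\<And>y. y > 0 \<Longrightarrow> (\<integral>\<^sup>+x. ennreal (cmod (F (Complex x y)) powr p) \<partial>lborel) \<le> ennreal M" and M0: "M \<ge> 0"
  shows "cmod (window_mean h F w) powr p \<le> M / h"
proof -
  have y: "Im w > 0" using w by (simp add: upper_half_plane_def)
  have [measurable]: "(\<lambda>x. F (Complex x (Im w))) \<in> borel_measurable borel"
    by (rule borel_measurable_horizontal_line[OF F y])
  have eq: "w + of_real (h * s) = Complex (Re w + h * s) (Im w)" for s by (simp add: complex_eq_iff)
  have "ennreal h * ennreal (cmod (window_mean h F w) powr p)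
     \<le> ennreal h * (\<integral>\<^sup>+s. ennreal (indicator {0..1} s) * ennreal (cmod (F (w + of_real (h * s))) powr p) \<partial>lborel)"
    by (intro mult_left_mono window_mean_powr_le F w p) auto
  also have "\<dots> \<le> ennreal h * (\<integral>\<^sup>+s. ennreal (cmod (F (Complex (Re w + h * s) (Im w))) powr p) \<partial>lborel)"
    unfolding eq by (intro mult_left_mono nn_integral_mono) (auto simp: indicator_def)
  also have "\<dots> = (\<integral>\<^sup>+x. ennreal (cmod (F (Complex x (Im w))) powr p) \<partial>lborel)"
    using h nn_integral_real_affine[of "\<lambda>x. ennreal (cmod (F (Complex x (Im w))) powr p)" h "Re w"] by simp
  also have "\<dots> \<le> ennreal M" by (rule M[OF y])
  finally show ?thesis
    using h M0 by (simp add: ennreal_mult[symmetric] field_simps)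
qed

text \<open>
  Jensen's inequality and Tonelli's theorem, together with the translation invariance of Lebesgue
  measure.
\<close>

lemma nn_integral_window_mean_le:
  assumes F: "F holomorphic_on upper_half_plane" and y: "y > 0" and p: "p \<ge> 1"
  shows "(\<integral>\<^sup>+x. ennreal (cmod (window_mean h F (Complex x y)) powr p) \<partial>lborel)
      \<le> (\<integral>\<^sup>+x. ennreal (cmod (F (Complex x y)) powr p) \<partial>lborel)" (is "_ \<le> ?I")
proof -
  define K where "K = (\<lambda>x. ennreal (cmod (F (Complex x y)) powr p))"
  have [measurable]: "(\<lambda>x. F (Complex x y)) \<in> borel_measurable borel"
    by (rule borel_measurable_horizontal_line[OF F y])
  have Km [measurable]: "K \<in> borel_measurable borel" unfolding K_def by measurable
  have eq: "Complex x y + of_real (h * s) = Complex (x + h * s) y" for s x by (simp add: complex_eq_iff)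
  have shift: "(\<integral>\<^sup>+x. K (x + h * s) \<partial>lborel) = ?I" for s
    using nn_integral_real_affine[of K 1 "h * s"] by (simp add: K_def add.commute)
  have "(\<integral>\<^sup>+x. ennreal (cmod (window_mean h F (Complex x y)) powr p) \<partial>lborel)
     \<le> (\<integral>\<^sup>+x. (\<integral>\<^sup>+s. ennreal (indicator {0..1} s) * K (x + h * s) \<partial>lborel) \<partial>lborel)"
    unfolding K_def eq[symmetric]
    by (intro nn_integral_mono window_mean_powr_le F p) (use y in auto)
  also have "\<dots> = (\<integral>\<^sup>+s. (\<integral>\<^sup>+x. ennreal (indicator {0..1} s) * K (x + h * s) \<partial>lborel) \<partial>lborel)"
    by (rule lborel_pair.Fubini'[symmetric]) measurable
  also have "\<dots> = (\<integral>\<^sup>+s. ennreal (indicator {0..1} (s::real)) * ?I \<partial>lborel)"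
    by (intro nn_integral_cong) (simp add: nn_integral_cmult shift)
  also have "\<dots> = ?I"
    by (simp add: nn_integral_multc ennreal_indicator)
  finally show ?thesis .
qed

text \<open>
  On the half-plane, \<open>F\<close> has a primitive, and the average is a difference quotient of it.
\<close>

lemma holomorphic_window_mean:
  assumes F: "F holomorphic_on upper_half_plane" and h: "h > 0"
  shows "window_mean h F holomorphic_on upper_half_plane"
proof -
  obtain \<Phi> where \<Phi>: "\<And>z. z \<in> upper_half_plane \<Longrightarrow> (\<Phi> has_field_derivative F z) (at z within upper_half_plane)"
    using holomorphic_convex_primitive'[OF _ _ F] by auto
  have \<Phi>': "(\<Phi> has_field_derivative F z) (at z)" if "z \<in> upper_half_plane" for z
    using \<Phi>[OF that] that by (simp add: at_within_open[OF that])
  then have hol: "\<Phi> holomorphic_on upper_half_plane"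
    by (auto simp: holomorphic_on_open)
  have shift: "w + of_real (h * s) \<in> upper_half_plane" if "w \<in> upper_half_plane" for w s
    using that by (simp add: upper_half_plane_def)
  have eq: "window_mean h F w = (\<Phi> (w + of_real h) - \<Phi> w) / of_real h" if w: "w \<in> upper_half_plane" for w
  proof -
    have D: "((\<lambda>s. \<Phi> (w + of_real (h * s)) / of_real h) has_vector_derivative F (w + of_real (h * s))) (at s within {0..1})" for s
    proof -
      have "((\<lambda>u. \<Phi> (w + of_real h * u)) has_field_derivative F (w + of_real h * of_real s) * of_real h) (at (of_real s))"
        using \<Phi>'[OF shift[OF w, of s]]
        by (intro DERIV_chain2[where f = \<Phi>]) (auto intro!: derivative_eq_intros)
      then have "((\<lambda>u. \<Phi> (w + of_real h * u) / of_real h) has_field_derivative F (w + of_real h * of_real s)) (at (of_real s))"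
        using h by (auto intro!: derivative_eq_intros)
      from has_vector_derivative_real_field[OF this] show ?thesis by simp
    qed
    have "((\<lambda>s. F (w + of_real (h * s))) has_integral (\<Phi> (w + of_real (h * 1)) / of_real h - \<Phi> (w + of_real (h * 0)) / of_real h)) {0..1}"
      by (rule fundamental_theorem_of_calculus) (use D in auto)
    moreover have "set_integrable lborel {0..1} (\<lambda>s. F (w + of_real (h * s)))"
      unfolding set_integrable_def by (rule integrable_window[OF F w])
    ultimately show ?thesis
      using set_borel_integral_eq_integral(2)[of "{0..1}" "\<lambda>s. F (w + of_real (h * s))"]
      by (simp add: window_mean_def set_lebesgue_integral_def integral_unique diff_divide_distrib)
  qed
  have "(\<lambda>w. (\<Phi> (w + of_real h) - \<Phi> w) / of_real h) holomorphic_on upper_half_plane"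
    using h by (intro holomorphic_intros hol holomorphic_on_compose_gen[OF _ hol, unfolded o_def])
       (auto simp: upper_half_plane_def)
  then show ?thesis by (rule holomorphic_transform) (simp add: eq)
qed

lemma window_mean_tendsto:
  assumes F: "F holomorphic_on upper_half_plane" and w: "w \<in> upper_half_plane"
  shows "(\<lambda>n. window_mean (1 / real (Suc n)) F w) \<longlonglongrightarrow> F w"
proof -
  let ?g = "\<lambda>s::real. F (w + of_real s)"
  have cont: "continuous_on A ?g" for A
    using continuous_on_window[OF F w, of A 1] by simp
  have "compact (?g ` {0..1})" by (intro compact_continuous_image cont) auto
  then obtain K where K: "\<And>s. s \<in> {0..1} \<Longrightarrow> cmod (?g s) \<le> K"
    by (meson bounded_iff compact_imp_bounded imageI)
  have "(\<lambda>n. LINT s|lborel. indicator {0..1} s *\<^sub>R F (w + of_real (1 / real (Suc n) * s)))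
     \<longlonglongrightarrow> (LINT s|lborel. indicator {0..1} (s::real) *\<^sub>R F w)"
  proof (rule integral_dominated_convergence[where w="\<lambda>s. indicator {0..1} s *\<^sub>R K"])
    show "AE s in lborel. (\<lambda>n. indicator {0..1} s *\<^sub>R F (w + of_real (1 / real (Suc n) * s))) \<longlonglongrightarrow> indicator {0..1} s *\<^sub>R F w"
    proof (intro AE_I2 tendsto_scaleR tendsto_const)
      fix s :: real
      have "isCont ?g 0" using cont[of UNIV] by (simp add: continuous_on_eq_continuous_at)
      moreover have "(\<lambda>n. 1 / real (Suc n) * s) \<longlonglongrightarrow> 0"
        using tendsto_mult[OF LIMSEQ_inverse_real_of_nat tendsto_const[of s]] by (simp add: inverse_eq_divide)
      ultimately show "(\<lambda>n. F (w + of_real (1 / real (Suc n) * s))) \<longlonglongrightarrow> F w"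
        using isCont_tendsto_compose[of 0 ?g] by fastforce
    qed
    show "AE s in lborel. norm (indicator {0..1} s *\<^sub>R F (w + of_real (1 / real (Suc n) * s))) \<le> indicator {0..1} s *\<^sub>R K" for n
    proof (intro AE_I2)
      fix s :: real
      show "norm (indicator {0..1} s *\<^sub>R F (w + of_real (1 / real (Suc n) * s))) \<le> indicator {0..1} s *\<^sub>R K"
        using K[of "1 / real (Suc n) * s"] by (auto simp: indicator_def field_simps)
    qed
    show "(\<lambda>s. indicator {0..1} s *\<^sub>R F (w + of_real (1 / real (Suc n) * s))) \<in> borel_measurable lborel" for n
      using integrable_window[OF F w] by (rule borel_measurable_integrable)
  qed auto
  then show ?thesis by (simp add: window_mean_def)
qed

text \<open>
  The bound for bounded functions applies to the averages of \<open>F\<close> and is uniform in their length;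
  Fatou's lemma passes to the limit.
\<close>

lemma nn_integral_compose_le:
  assumes hol: "\<phi> holomorphic_on upper_half_plane" and c: "c > 0"
    and low: "\<And>z. z \<in> upper_half_plane \<Longrightarrow> c * Im z \<le> Im (\<phi> z)" and y: "y > 0"
    and F: "F holomorphic_on upper_half_plane" and p: "p \<ge> 1"
    and M: "\<And>y. y > 0 \<Longrightarrow> (\<integral>\<^sup>+x. ennreal (cmod (F (Complex x y)) powr p) \<partial>lborel) \<le> ennreal M" and M0: "M \<ge> 0"
  shows "(\<integral>\<^sup>+x. ennreal (cmod (F (\<phi> (Complex x y))) powr p) \<partial>lborel) \<le> ennreal (M / c)"
proof -
  define G where "G = (\<lambda>n::nat. window_mean (1 / real (Suc n)) F)"
  have \<phi>U: "\<phi> (Complex x y) \<in> upper_half_plane" for x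
  proof -
    have "0 < c * y" using c y by simp
    also have "c * y \<le> Im (\<phi> (Complex x y))" using low[of "Complex x y"] y by simp
    finally show ?thesis by (simp add: upper_half_plane_def)
  qed
  have holG: "G n holomorphic_on upper_half_plane" for n
    unfolding G_def by (rule holomorphic_window_mean[OF F]) auto
  have bdG: "cmod (G n z) \<le> (M * real (Suc n)) powr (1 / p)" if "z \<in> upper_half_plane" for n z
  proof -
    have "cmod (G n z) powr p \<le> M * real (Suc n)"
      using window_mean_bounded[OF F that p _ M M0, of "1 / real (Suc n)"] by (simp add: G_def mult.commute)
    then have "(cmod (G n z) powr p) powr (1 / p) \<le> (M * real (Suc n)) powr (1 / p)"
      using p by (intro powr_mono2) auto
    then show ?thesis using p by (simp add: powr_powr)
  qed
  have Gm [measurable]: "(\<lambda>x. G n (\<phi> (Complex x y))) \<in> borel_measurable borel" for n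
  proof (rule borel_measurable_continuous_onI)
    show "continuous_on UNIV (\<lambda>x. G n (\<phi> (Complex x y)))"
      by (rule continuous_on_compose2[OF holomorphic_on_imp_continuous_on[OF holG] continuous_on_horizontal_line[OF hol y]])
         (use \<phi>U in auto)
  qed
  have each: "(\<integral>\<^sup>+x. ennreal (cmod (G n (\<phi> (Complex x y))) powr p) \<partial>lborel) \<le> ennreal (M / c)" for n
  proof -
    have e: "c * y / 4 > 0" using c y by simp
    have "(\<integral>\<^sup>+x. ennreal (cmod (G n (\<phi> (Complex x y))) powr p) \<partial>lborel)
        \<le> ennreal (1 / c) * (\<integral>\<^sup>+t. ennreal (cmod (G n (Complex t (c * y / 4))) powr p) \<partial>lborel)"
      by (rule nn_integral_compose_bounded[OF hol c low y holG bdG p])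
    also have "\<dots> \<le> ennreal (1 / c) * (\<integral>\<^sup>+t. ennreal (cmod (F (Complex t (c * y / 4))) powr p) \<partial>lborel)"
      unfolding G_def by (intro mult_left_mono nn_integral_window_mean_le F e p) auto
    also have "\<dots> \<le> ennreal (1 / c) * ennreal M"
      by (intro mult_left_mono M e) auto
    also have "\<dots> = ennreal (M / c)" using c M0 by (simp add: ennreal_mult[symmetric])
    finally show ?thesis .
  qed
  have lim: "(\<lambda>n. cmod (G n (\<phi> (Complex x y))) powr p) \<longlonglongrightarrow> cmod (F (\<phi> (Complex x y))) powr p" for x
    unfolding G_def using p
    by (intro tendsto_powr' tendsto_norm window_mean_tendsto[OF F \<phi>U] tendsto_const) auto
  have "(\<integral>\<^sup>+x. ennreal (cmod (F (\<phi> (Complex x y))) powr p) \<partial>lborel)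
     = (\<integral>\<^sup>+x. liminf (\<lambda>n. ennreal (cmod (G n (\<phi> (Complex x y))) powr p)) \<partial>lborel)"
    using lim by (intro nn_integral_cong lim_imp_Liminf[symmetric] tendsto_ennrealI) auto
  also have "\<dots> \<le> liminf (\<lambda>n. \<integral>\<^sup>+x. ennreal (cmod (G n (\<phi> (Complex x y))) powr p) \<partial>lborel)"
    by (rule nn_integral_liminf) measurable
  also have "\<dots> \<le> liminf (\<lambda>n. ennreal (M / c))"
    by (intro Liminf_mono always_eventually allI each)
  also have "\<dots> = ennreal (M / c)" by (simp add: Liminf_const)
  finally show ?thesis .
qed

section \<open>Bounds in Hardy spaces\<close>

lemma add_powr_le:
  fixes a b q :: real
  assumes "a \<ge> 0" "b \<ge> 0" "q \<ge> 1"
  shows "(a + b) powr q \<le> 2 powr q * (a powr q + b powr q)"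
proof -
  have "(a + b) powr q \<le> (2 * max a b) powr q" using assms by (intro powr_mono2) auto
  also have "\<dots> = 2 powr q * (max a b) powr q" using assms by (simp add: powr_mult)
  also have "\<dots> \<le> 2 powr q * (a powr q + b powr q)" by (intro mult_left_mono) (auto simp: max_def)
  finally show ?thesis .
qed

lemma two_powr_two_le:
  fixes M q :: real
  assumes "M \<ge> 0" "q \<ge> 1" shows "2 powr q * (M powr q + M powr q) \<le> (4 * M) powr q"
proof -
  have "2 powr 1 \<le> 2 powr q" using assms by (intro powr_mono) auto
  then have "2 powr q * (2 * M powr q) \<le> 2 powr q * (2 powr q * M powr q)"
    by (intro mult_left_mono mult_right_mono) auto
  also have "\<dots> = (4 * M) powr q" using assms powr_mult[of 2 2 q] by (simp add: powr_mult)
  finally show ?thesis by simp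
qed

text \<open>
  The relation \<open>F \<in> hardy_space p\<close> with \<open>hardy_norm p F \<le> M\<close>, expressed through the \<open>p\<close>-th powers of
  the means. Finiteness of the nonnegative integral includes integrability, so membership and
  estimate propagate together.
\<close>

definition hardy_bounded_by :: "ennreal \<Rightarrow> real \<Rightarrow> (complex \<Rightarrow> complex) \<Rightarrow> bool" where
  "hardy_bounded_by p M F \<longleftrightarrow> F holomorphic_on upper_half_plane \<and>
     (if p = \<infinity> then \<forall>z\<in>upper_half_plane. cmod (F z) \<le> M
      else \<forall>y>0. (\<integral>\<^sup>+x. ennreal (cmod (F (Complex x y)) powr enn2real p) \<partial>lborel) \<le> ennreal (M powr enn2real p))"

lemma enn2real_ge_1: "1 \<le> p \<Longrightarrow> p \<noteq> \<infinity> \<Longrightarrow> enn2real p \<ge> 1"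
  using enn2real_mono[of 1 p] by (simp add: less_top)

lemma hardy_mean_nonneg: "hardy_mean q F y \<ge> 0"
  by (simp add: hardy_mean_def)

lemma hardy_norm_nonneg:
  assumes "F \<in> hardy_space p" shows "hardy_norm p F \<ge> 0"
proof (cases "p = \<infinity>")
  case True
  then have "cmod (F \<i>) \<le> hardy_norm p F"
    using assms by (auto simp: hardy_norm_def hardy_space_def upper_half_plane_def intro!: cSUP_upper)
  then show ?thesis by (meson norm_ge_zero order_trans)
next
  case False
  then have "hardy_mean (enn2real p) F 1 \<le> hardy_norm p F"
    using assms by (auto simp: hardy_norm_def hardy_space_def intro!: cSUP_upper)
  then show ?thesis using hardy_mean_nonneg order_trans by blast
qed

lemma hardy_bounded_by_hardy_norm:
  assumes F: "F \<in> hardy_space p" and p: "1 \<le> p"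
  shows "hardy_bounded_by p (hardy_norm p F) F"
proof (cases "p = \<infinity>")
  case True
  then show ?thesis
    using F by (auto simp: hardy_bounded_by_def hardy_norm_def hardy_space_def intro!: cSUP_upper)
next
  case False
  define q where "q = enn2real p"
  have q: "q \<ge> 1" unfolding q_def by (rule enn2real_ge_1[OF p False])
  have "(\<integral>\<^sup>+x. ennreal (cmod (F (Complex x y)) powr q) \<partial>lborel) \<le> ennreal (hardy_norm p F powr q)" if y: "y > 0" for y
  proof -
    define I where "I = (LINT x|lborel. cmod (F (Complex x y)) powr q)"
    have "I \<ge> 0" by (simp add: I_def)
    have i: "integrable lborel (\<lambda>x. cmod (F (Complex x y)) powr q)"
      using F False y by (simp add: hardy_space_def q_def)
    have "hardy_mean q F y \<le> hardy_norm p F"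
      using F False y by (auto simp: hardy_norm_def hardy_space_def q_def intro!: cSUP_upper)
    then have "(I powr (1 / q)) powr q \<le> hardy_norm p F powr q"
      using q by (intro powr_mono2) (auto simp: hardy_mean_def I_def)
    then have "I \<le> hardy_norm p F powr q" using q \<open>I \<ge> 0\<close> by (simp add: powr_powr)
    moreover have "(\<integral>\<^sup>+x. ennreal (cmod (F (Complex x y)) powr q) \<partial>lborel) = ennreal I"
      unfolding I_def using i by (intro nn_integral_eq_integral) auto
    ultimately show ?thesis by (simp add: ennreal_leI)
  qed
  then show ?thesis using F False by (simp add: hardy_bounded_by_def hardy_space_def q_def)
qed

lemma hardy_bounded_byD:
  assumes F: "hardy_bounded_by p M F" and p: "1 \<le> p" and M: "M \<ge> 0"
  shows "F \<in> hardy_space p" and "hardy_norm p F \<le> M"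
proof -
  have hol: "F holomorphic_on upper_half_plane" using F by (simp add: hardy_bounded_by_def)
  have "F \<in> hardy_space p \<and> hardy_norm p F \<le> M"
  proof (cases "p = \<infinity>")
    case True
    then have b: "\<And>z. z \<in> upper_half_plane \<Longrightarrow> cmod (F z) \<le> M" using F by (simp add: hardy_bounded_by_def)
    have "\<i> \<in> upper_half_plane" by (simp add: upper_half_plane_def)
    then have "hardy_norm p F \<le> M"
      using True b by (auto simp: hardy_norm_def intro!: cSUP_least)
    moreover have "bdd_above ((\<lambda>z. cmod (F z)) ` upper_half_plane)" using b by (rule bdd_aboveI2)
    ultimately show ?thesis using True hol by (simp add: hardy_space_def)
  next
    case False
    define q where "q = enn2real p"
    have q: "q \<ge> 1" unfolding q_def by (rule enn2real_ge_1[OF p False])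
    have line: "integrable lborel (\<lambda>x. cmod (F (Complex x y)) powr q) \<and> hardy_mean q F y \<le> M" if y: "y > 0" for y
    proof -
      have [measurable]: "(\<lambda>x. F (Complex x y)) \<in> borel_measurable borel"
        by (rule borel_measurable_horizontal_line[OF hol y])
      have b: "(\<integral>\<^sup>+x. ennreal (cmod (F (Complex x y)) powr q) \<partial>lborel) \<le> ennreal (M powr q)"
        using F False y by (simp add: hardy_bounded_by_def q_def)
      have i: "integrable lborel (\<lambda>x. cmod (F (Complex x y)) powr q)"
        by (rule integrableI_nonneg) (use b in \<open>auto intro: le_less_trans\<close>)
      then have "ennreal (LINT x|lborel. cmod (F (Complex x y)) powr q) \<le> ennreal (M powr q)"
        using b nn_integral_eq_integral[OF i] by simp
      then have "(LINT x|lborel. cmod (F (Complex x y)) powr q) \<le> M powr q" by simp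
      then have "hardy_mean q F y \<le> (M powr q) powr (1 / q)"
        unfolding hardy_mean_def using q by (intro powr_mono2) auto
      then show ?thesis using i q M by (simp add: powr_powr)
    qed
    then have "bdd_above (hardy_mean q F ` {0<..})" by (intro bdd_aboveI2[of _ _ M]) auto
    moreover have "(SUP y\<in>{0<..}. hardy_mean q F y) \<le> M"
      using line by (intro cSUP_least) auto
    ultimately show ?thesis using False hol line by (simp add: hardy_space_def hardy_norm_def q_def)
  qed
  then show "F \<in> hardy_space p" "hardy_norm p F \<le> M" by auto
qed

lemma hardy_bounded_by_mono:
  assumes "hardy_bounded_by p M F" "0 \<le> M" "M \<le> N"
  shows "hardy_bounded_by p N F"
proof -
  have "ennreal (M powr enn2real p) \<le> ennreal (N powr enn2real p)"
    using assms by (intro ennreal_leI powr_mono2) auto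
  then show ?thesis using assms(1,3) unfolding hardy_bounded_by_def by (fastforce split: if_splits intro: order_trans)
qed

lemma hardy_bounded_by_cong:
  assumes "\<And>z. z \<in> upper_half_plane \<Longrightarrow> F z = G z"
  shows "hardy_bounded_by p M F \<longleftrightarrow> hardy_bounded_by p M G"
proof -
  have "F (Complex x y) = G (Complex x y)" if "y > 0" for x y using assms that by simp
  then show ?thesis
    using assms by (simp add: hardy_bounded_by_def cong: holomorphic_cong)
qed

text \<open>
  The factor \<open>4\<close> instead of Minkowski's \<open>2\<close> comes from the cruder
  \<open>(a + b) powr q \<le> 2 powr q * (a powr q + b powr q)\<close>; only the existence of a constant matters below.
\<close>

lemma hardy_bounded_by_add:
  assumes F: "hardy_bounded_by p M F" and G: "hardy_bounded_by p M G" and p: "1 \<le> p" and M: "M \<ge> 0"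
  shows "hardy_bounded_by p (4 * M) (\<lambda>z. F z + G z)"
proof -
  have hol: "F holomorphic_on upper_half_plane" "G holomorphic_on upper_half_plane"
    using F G by (auto simp: hardy_bounded_by_def)
  then have holFG: "(\<lambda>z. F z + G z) holomorphic_on upper_half_plane" by (intro holomorphic_intros)
  show ?thesis
  proof (cases "p = \<infinity>")
    case True
    have "cmod (F z + G z) \<le> 4 * M" if "z \<in> upper_half_plane" for z
    proof -
      have "cmod (F z) \<le> M" "cmod (G z) \<le> M" using F G True that by (auto simp: hardy_bounded_by_def)
      then show ?thesis using norm_triangle_ineq[of "F z" "G z"] M by linarith
    qed
    then show ?thesis using True holFG by (simp add: hardy_bounded_by_def)
  next
    case False
    define q where "q = enn2real p"
    have q: "q \<ge> 1" unfolding q_def by (rule enn2real_ge_1[OF p False])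
    have "(\<integral>\<^sup>+x. ennreal (cmod (F (Complex x y) + G (Complex x y)) powr q) \<partial>lborel) \<le> ennreal ((4 * M) powr q)" if y: "y > 0" for y
    proof -
      note [measurable] = borel_measurable_horizontal_line[OF hol(1) y] borel_measurable_horizontal_line[OF hol(2) y]
      let ?f = "\<lambda>x. cmod (F (Complex x y)) powr q" and ?g = "\<lambda>x. cmod (G (Complex x y)) powr q"
      have "(\<integral>\<^sup>+x. ennreal (cmod (F (Complex x y) + G (Complex x y)) powr q) \<partial>lborel)
         \<le> (\<integral>\<^sup>+x. ennreal (2 powr q) * (ennreal (?f x) + ennreal (?g x)) \<partial>lborel)"
      proof (intro nn_integral_mono)
        fix x
        have "cmod (F (Complex x y) + G (Complex x y)) powr q \<le> (cmod (F (Complex x y)) + cmod (G (Complex x y))) powr q"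
          using q by (intro powr_mono2 norm_triangle_ineq) auto
        also have "\<dots> \<le> 2 powr q * (?f x + ?g x)" using q by (intro add_powr_le) auto
        finally show "ennreal (cmod (F (Complex x y) + G (Complex x y)) powr q) \<le> ennreal (2 powr q) * (ennreal (?f x) + ennreal (?g x))"
          by (simp add: ennreal_mult[symmetric] ennreal_plus[symmetric] ennreal_leI del: ennreal_plus)
      qed
      also have "\<dots> = ennreal (2 powr q) * ((\<integral>\<^sup>+x. ennreal (?f x) \<partial>lborel) + (\<integral>\<^sup>+x. ennreal (?g x) \<partial>lborel))"
        by (simp add: nn_integral_cmult nn_integral_add)
      also have "\<dots> \<le> ennreal (2 powr q) * (ennreal (M powr q) + ennreal (M powr q))"
        using F G False y by (intro mult_left_mono add_mono) (auto simp: hardy_bounded_by_def q_def)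
      also have "\<dots> = ennreal (2 powr q * (M powr q + M powr q))"
        by (simp add: ennreal_mult[symmetric] ennreal_plus[symmetric] del: ennreal_plus)
      also have "\<dots> \<le> ennreal ((4 * M) powr q)" by (intro ennreal_leI two_powr_two_le M q)
      finally show ?thesis .
    qed
    then show ?thesis using False holFG by (simp add: hardy_bounded_by_def q_def)
  qed
qed

lemma hardy_bounded_by_mult:
  assumes f: "hardy_bounded_by \<infinity> M f" and G: "hardy_bounded_by p N G" and M: "M \<ge> 0" and N: "N \<ge> 0"
  shows "hardy_bounded_by p (M * N) (\<lambda>z. f z * G z)"
proof -
  have hol: "f holomorphic_on upper_half_plane" "G holomorphic_on upper_half_plane"
    using f G by (auto simp: hardy_bounded_by_def)
  then have holfG: "(\<lambda>z. f z * G z) holomorphic_on upper_half_plane" by (intro holomorphic_intros)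
  have fM: "cmod (f z) \<le> M" if "z \<in> upper_half_plane" for z using f that by (simp add: hardy_bounded_by_def)
  show ?thesis
  proof (cases "p = \<infinity>")
    case True
    then show ?thesis using G fM holfG M by (auto simp: hardy_bounded_by_def norm_mult intro!: mult_mono)
  next
    case False
    define q where "q = enn2real p"
    have "(\<integral>\<^sup>+x. ennreal (cmod (f (Complex x y) * G (Complex x y)) powr q) \<partial>lborel) \<le> ennreal ((M * N) powr q)" if y: "y > 0" for y
    proof -
      note [measurable] = borel_measurable_horizontal_line[OF hol(2) y]
      have "(\<integral>\<^sup>+x. ennreal (cmod (f (Complex x y) * G (Complex x y)) powr q) \<partial>lborel)
        \<le> (\<integral>\<^sup>+x. ennreal (M powr q) * ennreal (cmod (G (Complex x y)) powr q) \<partial>lborel)"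
        using fM y
        by (intro nn_integral_mono)
           (auto simp: norm_mult powr_mult ennreal_mult[symmetric] q_def intro!: ennreal_leI mult_right_mono powr_mono2)
      also have "\<dots> = ennreal (M powr q) * (\<integral>\<^sup>+x. ennreal (cmod (G (Complex x y)) powr q) \<partial>lborel)"
        by (rule nn_integral_cmult) measurable
      also have "\<dots> \<le> ennreal (M powr q) * ennreal (N powr q)"
        using G False y by (intro mult_left_mono) (auto simp: hardy_bounded_by_def q_def)
      also have "\<dots> = ennreal ((M * N) powr q)" using M N by (simp add: powr_mult ennreal_mult)
      finally show ?thesis .
    qed
    then show ?thesis using False holfG by (simp add: hardy_bounded_by_def q_def)
  qed
qed

text \<open>
  The factor is \<open>(1 / c) powr (1 / p)\<close> for finite \<open>p\<close> and \<open>1\<close> for \<open>p = \<infinity>\<close>; the maximum below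
  dominates all of these.
\<close>

lemma hardy_bounded_by_compose:
  assumes F: "hardy_bounded_by p M F" and p: "1 \<le> p" and M: "M \<ge> 0"
    and hol: "\<phi> holomorphic_on upper_half_plane" and self: "\<phi> ` upper_half_plane \<subseteq> upper_half_plane"
    and c: "c > 0" and low: "\<And>z. z \<in> upper_half_plane \<Longrightarrow> c * Im z \<le> Im (\<phi> z)"
  shows "hardy_bounded_by p (max 1 (1 / c) * M) (\<lambda>z. F (\<phi> z))"
proof -
  define K where "K = max 1 (1 / c)"
  have K: "K \<ge> 1" "K \<ge> 1 / c" by (auto simp: K_def)
  have holF: "F holomorphic_on upper_half_plane" using F by (simp add: hardy_bounded_by_def)
  have holFG: "(\<lambda>z. F (\<phi> z)) holomorphic_on upper_half_plane"
    by (rule holomorphic_on_compose_gen[OF hol holF, unfolded o_def]) (use self in auto)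
  show ?thesis
  proof (cases "p = \<infinity>")
    case True
    have "cmod (F (\<phi> z)) \<le> K * M" if "z \<in> upper_half_plane" for z
    proof -
      have "cmod (F (\<phi> z)) \<le> M" using F True that self by (auto simp: hardy_bounded_by_def)
      also have "\<dots> \<le> K * M" using K M by (simp add: mult_le_cancel_right1)
      finally show ?thesis .
    qed
    then show ?thesis using True holFG by (simp add: hardy_bounded_by_def K_def)
  next
    case False
    define q where "q = enn2real p"
    have q: "q \<ge> 1" unfolding q_def by (rule enn2real_ge_1[OF p False])
    have "(\<integral>\<^sup>+x. ennreal (cmod (F (\<phi> (Complex x y))) powr q) \<partial>lborel) \<le> ennreal ((K * M) powr q)" if y: "y > 0" for y
    proof -
      have "(\<integral>\<^sup>+x. ennreal (cmod (F (\<phi> (Complex x y))) powr q) \<partial>lborel) \<le> ennreal (M powr q / c)"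
        by (rule nn_integral_compose_le[OF hol c low y holF q])
           (use F False in \<open>auto simp: hardy_bounded_by_def q_def\<close>)
      also have "M powr q / c \<le> (K * M) powr q"
      proof -
        have "K powr 1 \<le> K powr q" using K q by (intro powr_mono) auto
        then have "1 / c \<le> K powr q" using K by simp
        then have "1 / c * M powr q \<le> K powr q * M powr q" by (intro mult_right_mono) auto
        then show ?thesis using K M by (simp add: powr_mult)
      qed
      finally show ?thesis by (simp add: ennreal_leI)
    qed
    then show ?thesis using False holFG by (simp add: hardy_bounded_by_def q_def K_def)
  qed
qed

text \<open>
  Integration by parts gives
  \<open>F z = \<integral> (F (z + s) - (1 - s) F' (z + s)) ds\<close> over \<open>0 \<le> s \<le> 1\<close>,
  and Jensen's inequality bounds the right side by the
  integrals of \<open>\<bar>F\<bar> powr p\<close> and \<open>\<bar>F'\<bar> powr p\<close> over the horizontal line through \<open>z\<close>.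
\<close>

lemma hardy_sobolev_embedding:
  assumes F: "hardy_bounded_by p M F" and F': "hardy_bounded_by p M (deriv F)" and p: "1 \<le> p" and M: "M \<ge> 0"
  shows "hardy_bounded_by \<infinity> (4 * M) F"
proof (cases "p = \<infinity>")
  case True
  then show ?thesis using F M hardy_bounded_by_mono[of \<infinity> M F "4 * M"] by simp
next
  case False
  define q where "q = enn2real p"
  have q: "q \<ge> 1" unfolding q_def by (rule enn2real_ge_1[OF p False])
  have hol: "F holomorphic_on upper_half_plane" "deriv F holomorphic_on upper_half_plane"
    using F F' by (auto simp: hardy_bounded_by_def)
  have "cmod (F z) \<le> 4 * M" if z: "z \<in> upper_half_plane" for z
  proof -
    define y where "y = Im z"
    have y: "y > 0" using z by (simp add: y_def upper_half_plane_def)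
    note [measurable] = borel_measurable_horizontal_line[OF hol(1) y] borel_measurable_horizontal_line[OF hol(2) y]
    have zs: "z + of_real s = Complex (Re z + 1 * s) y" for s by (simp add: complex_eq_iff y_def)
    define H where "H = (\<lambda>s. F (z + of_real s) - of_real (1 - s) * deriv F (z + of_real s))"
    have shift: "z + of_real s \<in> upper_half_plane" for s using z by (simp add: upper_half_plane_def)
    have D: "((\<lambda>s. - of_real (1 - s) * F (z + of_real s)) has_vector_derivative H s) (at s within {0..1})" for s
    proof -
      have "(F has_field_derivative deriv F (z + of_real s)) (at (z + of_real s))"
        by (rule holomorphic_derivI[OF hol(1) _ shift]) simp
      then have "((\<lambda>u. F (z + u)) has_field_derivative deriv F (z + of_real s)) (at (of_real s))"
        using DERIV_shift[of F "deriv F (z + of_real s)" "of_real s" z] by (simp add: add.commute[of _ z])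
      then have "((\<lambda>u. - (1 - u) * F (z + u)) has_field_derivative H s) (at (of_real s))"
        by (auto intro!: derivative_eq_intros simp: H_def algebra_simps)
      from has_vector_derivative_real_field[OF this] show ?thesis by simp
    qed
    have contH: "continuous_on {0..1} H"
      unfolding H_def using continuous_on_window[OF hol(1) z, of _ 1] continuous_on_window[OF hol(2) z, of _ 1]
      by (intro continuous_intros) auto
    have Hm [measurable]: "H \<in> borel_measurable borel"
      unfolding H_def zs by measurable
    have int: "integrable lborel (\<lambda>s. indicator {0..1} s *\<^sub>R H s)"
      using borel_integrable_compact[OF _ contH] by (simp add: indicator_def if_distrib if_distribR cong: if_cong)
    have "(H has_integral (- of_real (1 - 1) * F (z + of_real 1) - (- of_real (1 - 0) * F (z + of_real 0)))) {0..1}"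
      by (rule fundamental_theorem_of_calculus) (use D in auto)
    then have FH: "(LINT s|lborel. indicator {0..1} s *\<^sub>R H s) = F z"
      using set_borel_integral_eq_integral(2)[of "{0..1}" H] int
      by (simp add: set_integrable_def set_lebesgue_integral_def integral_unique)
    let ?f = "\<lambda>x. cmod (F (Complex x y)) powr q" and ?g = "\<lambda>x. cmod (deriv F (Complex x y)) powr q"
    have "ennreal (cmod (F z) powr q) \<le> (\<integral>\<^sup>+s. ennreal (indicator {0..1} s) * ennreal (cmod (H s) powr q) \<partial>lborel)"
      unfolding FH[symmetric] by (rule weighted_mean_powr_le[OF q]) (use int in auto)
    also have "\<dots> \<le> (\<integral>\<^sup>+s. ennreal (2 powr q) * (ennreal (?f (Re z + 1 * s)) + ennreal (?g (Re z + 1 * s))) \<partial>lborel)"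
    proof (intro nn_integral_mono)
      fix s :: real
      show "ennreal (indicator {0..1} s) * ennreal (cmod (H s) powr q)
          \<le> ennreal (2 powr q) * (ennreal (?f (Re z + 1 * s)) + ennreal (?g (Re z + 1 * s)))"
      proof (cases "s \<in> {0..1}")
        case True
        have "cmod (of_real (1 - s) * deriv F (z + of_real s)) \<le> 1 * cmod (deriv F (z + of_real s))"
          unfolding norm_mult using True by (intro mult_right_mono) (auto simp del: of_real_diff)
        then have "cmod (H s) \<le> cmod (F (z + of_real s)) + cmod (deriv F (z + of_real s))"
          unfolding H_def using norm_triangle_ineq4[of "F (z + of_real s)" "of_real (1 - s) * deriv F (z + of_real s)"] by linarith
        then have "cmod (H s) powr q \<le> (cmod (F (z + of_real s)) + cmod (deriv F (z + of_real s))) powr q"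
          using q by (intro powr_mono2) auto
        also have "\<dots> \<le> 2 powr q * (?f (Re z + 1 * s) + ?g (Re z + 1 * s))"
          unfolding zs using q by (intro add_powr_le) auto
        finally show ?thesis using True
          by (simp add: ennreal_mult[symmetric] ennreal_plus[symmetric] ennreal_leI del: ennreal_plus)
      qed auto
    qed
    also have "\<dots> = ennreal (2 powr q) * ((\<integral>\<^sup>+s. ennreal (?f (Re z + 1 * s)) \<partial>lborel) + (\<integral>\<^sup>+s. ennreal (?g (Re z + 1 * s)) \<partial>lborel))"
      by (simp add: nn_integral_cmult nn_integral_add)
    also have "(\<integral>\<^sup>+s. ennreal (?f (Re z + 1 * s)) \<partial>lborel) = (\<integral>\<^sup>+x. ennreal (?f x) \<partial>lborel)"
      using nn_integral_real_affine[of "\<lambda>x. ennreal (?f x)" 1 "Re z"] by simp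
    also have "(\<integral>\<^sup>+s. ennreal (?g (Re z + 1 * s)) \<partial>lborel) = (\<integral>\<^sup>+x. ennreal (?g x) \<partial>lborel)"
      using nn_integral_real_affine[of "\<lambda>x. ennreal (?g x)" 1 "Re z"] by simp
    also have "ennreal (2 powr q) * ((\<integral>\<^sup>+x. ennreal (?f x) \<partial>lborel) + (\<integral>\<^sup>+x. ennreal (?g x) \<partial>lborel))
        \<le> ennreal (2 powr q) * (ennreal (M powr q) + ennreal (M powr q))"
      using F F' False y by (intro mult_left_mono add_mono) (auto simp: hardy_bounded_by_def q_def)
    also have "\<dots> = ennreal (2 powr q * (M powr q + M powr q))"
      by (simp add: ennreal_mult[symmetric] ennreal_plus[symmetric] del: ennreal_plus)
    also have "\<dots> \<le> ennreal ((4 * M) powr q)" by (intro ennreal_leI two_powr_two_le M q)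
    finally have "cmod (F z) powr q \<le> (4 * M) powr q" by simp
    then show ?thesis
      using powr_less_mono2[of q "4 * M" "cmod (F z)"] q M by (meson leD le_less_trans not_le zero_less_one less_le_trans mult_nonneg_nonneg zero_le_numeral)
  qed
  then show ?thesis using hol by (simp add: hardy_bounded_by_def)
qed

section \<open>Bounds in Hardy--Sobolev spaces\<close>

text \<open>
  One common bound for all derivatives, rather than the Hardy--Sobolev norm: it is equivalent up to
  the factor \<open>m + 1\<close>, and unlike the norm it satisfies a recursion in \<open>m\<close> that does not depend on \<open>p\<close>.
  The product and chain rules can then be iterated by induction on \<open>m\<close>.
\<close>

definition sobolev_bounded_by :: "nat \<Rightarrow> ennreal \<Rightarrow> real \<Rightarrow> (complex \<Rightarrow> complex) \<Rightarrow> bool" where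
  "sobolev_bounded_by m p M F \<longleftrightarrow> (\<forall>k\<le>m. hardy_bounded_by p M ((deriv ^^ k) F))"

lemma sobolev_bounded_by_0 [simp]: "sobolev_bounded_by 0 p M F \<longleftrightarrow> hardy_bounded_by p M F"
  by (simp add: sobolev_bounded_by_def)

lemma sobolev_bounded_by_Suc:
  "sobolev_bounded_by (Suc m) p M F \<longleftrightarrow> hardy_bounded_by p M F \<and> sobolev_bounded_by m p M (deriv F)"
proof -
  have "(\<forall>k\<le>Suc m. P k) \<longleftrightarrow> P 0 \<and> (\<forall>k\<le>m. P (Suc k))" for P
    by (metis Suc_le_mono le0 not0_implies_Suc)
  then show ?thesis by (simp add: sobolev_bounded_by_def funpow_swap1)
qed

lemma sobolev_bounded_byD:
  assumes "sobolev_bounded_by m p M F"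
  shows "hardy_bounded_by p M F" and "F holomorphic_on upper_half_plane"
proof -
  show "hardy_bounded_by p M F" using assms[unfolded sobolev_bounded_by_def, rule_format, of 0] by simp
  then show "F holomorphic_on upper_half_plane" by (simp add: hardy_bounded_by_def)
qed

lemma sobolev_bounded_by_le: "sobolev_bounded_by n p M F \<Longrightarrow> m \<le> n \<Longrightarrow> sobolev_bounded_by m p M F"
  by (simp add: sobolev_bounded_by_def)

lemma sobolev_bounded_by_mono:
  "sobolev_bounded_by m p M F \<Longrightarrow> 0 \<le> M \<Longrightarrow> M \<le> N \<Longrightarrow> sobolev_bounded_by m p N F"
  unfolding sobolev_bounded_by_def using hardy_bounded_by_mono by blast

lemma deriv_cong_upper_half_plane:
  assumes "\<And>z. z \<in> upper_half_plane \<Longrightarrow> F z = G z" "z \<in> upper_half_plane"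
  shows "deriv F z = deriv G z"
proof (rule deriv_cong_ev)
  show "\<forall>\<^sub>F x in nhds z. F x = G x"
    using assms by (auto simp: eventually_nhds intro!: exI[of _ upper_half_plane])
qed simp

lemma sobolev_bounded_by_cong:
  assumes "\<And>z. z \<in> upper_half_plane \<Longrightarrow> F z = G z"
  shows "sobolev_bounded_by m p M F \<longleftrightarrow> sobolev_bounded_by m p M G"
  using assms
proof (induction m arbitrary: F G)
  case 0
  show ?case unfolding sobolev_bounded_by_0 by (rule hardy_bounded_by_cong[OF 0])
next
  case (Suc m)
  have "sobolev_bounded_by m p M (deriv F) \<longleftrightarrow> sobolev_bounded_by m p M (deriv G)"
    by (rule Suc.IH) (rule deriv_cong_upper_half_plane[OF Suc.prems])
  then show ?case
    unfolding sobolev_bounded_by_Suc using hardy_bounded_by_cong[OF Suc.prems] by simp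
qed

lemma differentiable_upper_half_plane:
  "F holomorphic_on upper_half_plane \<Longrightarrow> z \<in> upper_half_plane \<Longrightarrow> F field_differentiable at z"
  by (rule holomorphic_on_imp_differentiable_at) auto

lemma sobolev_bounded_by_add:
  assumes "sobolev_bounded_by m p M F" "sobolev_bounded_by m p M G" and p: "1 \<le> p" and M: "M \<ge> 0"
  shows "sobolev_bounded_by m p (4 * M) (\<lambda>z. F z + G z)"
  using assms(1,2)
proof (induction m arbitrary: F G)
  case 0
  then show ?case by (simp add: hardy_bounded_by_add p M)
next
  case (Suc m)
  have "sobolev_bounded_by m p (4 * M) (\<lambda>z. deriv F z + deriv G z)"
    using Suc.prems by (intro Suc.IH) (auto simp: sobolev_bounded_by_Suc)
  moreover have "deriv (\<lambda>z. F z + G z) z = deriv F z + deriv G z" if "z \<in> upper_half_plane" for z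
    using sobolev_bounded_byD(2)[OF Suc.prems(1)] sobolev_bounded_byD(2)[OF Suc.prems(2)] that
    by (intro deriv_add differentiable_upper_half_plane)
  ultimately have "sobolev_bounded_by m p (4 * M) (deriv (\<lambda>z. F z + G z))"
    using sobolev_bounded_by_cong[of "deriv (\<lambda>z. F z + G z)" "\<lambda>z. deriv F z + deriv G z"] by blast
  moreover have "hardy_bounded_by p (4 * M) (\<lambda>z. F z + G z)"
    by (intro hardy_bounded_by_add sobolev_bounded_byD(1)[OF Suc.prems(1)] sobolev_bounded_byD(1)[OF Suc.prems(2)] p M)
  ultimately show ?case unfolding sobolev_bounded_by_Suc by (intro conjI)
qed

text \<open>
  One differentiation by the product rule; both product estimates below use it as their induction
  step.
\<close>

lemma sobolev_bounded_by_mult_Suc: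
  assumes f: "f holomorphic_on upper_half_plane" and G: "G holomorphic_on upper_half_plane"
    and "hardy_bounded_by p K (\<lambda>z. f z * G z)"
    and "sobolev_bounded_by m p K (\<lambda>z. f z * deriv G z)" "sobolev_bounded_by m p K (\<lambda>z. deriv f z * G z)"
    and p: "1 \<le> p" and K: "K \<ge> 0"
  shows "sobolev_bounded_by (Suc m) p (4 * K) (\<lambda>z. f z * G z)"
proof -
  have "sobolev_bounded_by m p (4 * K) (\<lambda>z. f z * deriv G z + deriv f z * G z)"
    by (intro sobolev_bounded_by_add assms)
  moreover have "deriv (\<lambda>z. f z * G z) z = f z * deriv G z + deriv f z * G z" if "z \<in> upper_half_plane" for z
    using f G that by (intro deriv_mult differentiable_upper_half_plane)
  ultimately have "sobolev_bounded_by m p (4 * K) (deriv (\<lambda>z. f z * G z))"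
    using sobolev_bounded_by_cong[of "deriv (\<lambda>z. f z * G z)" "\<lambda>z. f z * deriv G z + deriv f z * G z"] by blast
  moreover have "hardy_bounded_by p (4 * K) (\<lambda>z. f z * G z)"
    using assms(3) K by (rule hardy_bounded_by_mono) (use K in simp)
  ultimately show ?thesis by (simp add: sobolev_bounded_by_Suc)
qed

lemma sobolev_bounded_by_mult_bounded:
  assumes "sobolev_bounded_by m \<infinity> M f" "sobolev_bounded_by m p N G" and p: "1 \<le> p" and M: "M \<ge> 0" and N: "N \<ge> 0"
  shows "sobolev_bounded_by m p (4 ^ m * (M * N)) (\<lambda>z. f z * G z)"
  using assms(1,2)
proof (induction m arbitrary: f G)
  case 0
  then show ?case using hardy_bounded_by_mult M N by simp
next
  case (Suc m)
  note hb = sobolev_bounded_byD[OF Suc.prems(1)] sobolev_bounded_byD[OF Suc.prems(2)]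
  have one: "1 \<le> (4::real) ^ m" by simp
  have "sobolev_bounded_by (Suc m) p (4 * (4 ^ m * (M * N))) (\<lambda>z. f z * G z)"
  proof (rule sobolev_bounded_by_mult_Suc)
    show "hardy_bounded_by p (4 ^ m * (M * N)) (\<lambda>z. f z * G z)"
      by (rule hardy_bounded_by_mono[OF hardy_bounded_by_mult[OF hb(1) hb(3) M N]])
         (use M N mult_right_mono[OF one, of "M * N"] in auto)
    show "sobolev_bounded_by m p (4 ^ m * (M * N)) (\<lambda>z. f z * deriv G z)"
      using Suc.prems sobolev_bounded_by_le[OF Suc.prems(1), of m] by (intro Suc.IH) (auto simp: sobolev_bounded_by_Suc)
    show "sobolev_bounded_by m p (4 ^ m * (M * N)) (\<lambda>z. deriv f z * G z)"
      using Suc.prems sobolev_bounded_by_le[OF Suc.prems(2), of m] by (intro Suc.IH) (auto simp: sobolev_bounded_by_Suc)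
  qed (use hb p M N in auto)
  then show ?case by (simp add: mult.assoc)
qed

text \<open>
  Each term of the product rule has a factor whose derivative is still controlled, and this factor is bounded by
  \<open>hardy_sobolev_embedding\<close>. The induction starts at one because \<open>H\<^sup>p\<close> itself is not closed under
  products for finite \<open>p\<close>.
\<close>

lemma sobolev_bounded_by_mult:
  assumes "sobolev_bounded_by (Suc m) p M f" "sobolev_bounded_by (Suc m) p N G" and p: "1 \<le> p" and M: "M \<ge> 0" and N: "N \<ge> 0"
  shows "sobolev_bounded_by (Suc m) p (4 ^ (m + 2) * (M * N)) (\<lambda>z. f z * G z)"
  using assms(1,2)
proof (induction m arbitrary: f G)
  case 0
  have f: "hardy_bounded_by p M f" "hardy_bounded_by p M (deriv f)" and G: "hardy_bounded_by p N G" "hardy_bounded_by p N (deriv G)"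
    using 0 by (auto simp: sobolev_bounded_by_Suc)
  have f4: "hardy_bounded_by \<infinity> (4 * M) f" by (rule hardy_sobolev_embedding[OF f p M])
  have G4: "hardy_bounded_by \<infinity> (4 * N) G" by (rule hardy_sobolev_embedding[OF G p N])
  have "sobolev_bounded_by (Suc 0) p (4 * (4 * (M * N))) (\<lambda>z. f z * G z)"
  proof (rule sobolev_bounded_by_mult_Suc)
    show "hardy_bounded_by p (4 * (M * N)) (\<lambda>z. f z * G z)"
      using hardy_bounded_by_mult[OF f4 G(1)] M N by (simp add: mult.assoc)
    show "sobolev_bounded_by 0 p (4 * (M * N)) (\<lambda>z. f z * deriv G z)"
      using hardy_bounded_by_mult[OF f4 G(2)] M N by (simp add: mult.assoc)
    show "sobolev_bounded_by 0 p (4 * (M * N)) (\<lambda>z. deriv f z * G z)"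
      using hardy_bounded_by_mult[OF G4 f(2)] M N by (simp add: ac_simps)
  qed (use 0 sobolev_bounded_byD p M N in auto)
  then show ?case by simp
next
  case (Suc m)
  let ?K = "4 ^ (m + 2) * (M * N)"
  note hol = sobolev_bounded_byD(2)[OF Suc.prems(1)] sobolev_bounded_byD(2)[OF Suc.prems(2)]
  have low: "sobolev_bounded_by (Suc m) p M f" "sobolev_bounded_by (Suc m) p N G"
    using Suc.prems sobolev_bounded_by_le[of "Suc (Suc m)"] by auto
  have "sobolev_bounded_by (Suc (Suc m)) p (4 * ?K) (\<lambda>z. f z * G z)"
  proof (rule sobolev_bounded_by_mult_Suc[OF hol])
    show "hardy_bounded_by p ?K (\<lambda>z. f z * G z)"
      by (rule sobolev_bounded_byD(1)[OF Suc.IH[OF low]])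
    show "sobolev_bounded_by (Suc m) p ?K (\<lambda>z. f z * deriv G z)"
      using Suc.prems low by (intro Suc.IH) (auto simp: sobolev_bounded_by_Suc)
    show "sobolev_bounded_by (Suc m) p ?K (\<lambda>z. deriv f z * G z)"
      using Suc.prems low by (intro Suc.IH) (auto simp: sobolev_bounded_by_Suc)
  qed (use p M N in auto)
  then show ?case by (simp add: mult.assoc)
qed

text \<open>
  Induction on the order by the chain rule \<open>(F \<circ> \<phi>)' = \<phi>' \<cdot> (F' \<circ> \<phi>)\<close>: the order drops by one, and
  multiplication by \<open>\<phi>'\<close> is covered by the product estimate with a bounded factor.
\<close>

lemma sobolev_bounded_by_compose:
  assumes p: "1 \<le> p"
    and hol: "\<phi> holomorphic_on upper_half_plane" and self: "\<phi> ` upper_half_plane \<subseteq> upper_half_plane"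
    and c: "c > 0" and low: "\<And>z. z \<in> upper_half_plane \<Longrightarrow> c * Im z \<le> Im (\<phi> z)"
    and D: "sobolev_bounded_by (n - 1) \<infinity> D (deriv \<phi>)" "D \<ge> 0"
    and "m \<le> n"
  shows "\<exists>C\<ge>0. \<forall>F M. M \<ge> 0 \<longrightarrow> sobolev_bounded_by m p M F \<longrightarrow> sobolev_bounded_by m p (C * M) (\<lambda>z. F (\<phi> z))"
  using \<open>m \<le> n\<close>
proof (induction m)
  case 0
  show ?case
    using hardy_bounded_by_compose[OF _ p _ hol self c low] by (intro exI[of _ "max 1 (1 / c)"]) auto
next
  case (Suc m)
  then obtain C where C: "C \<ge> 0" "\<And>F M. M \<ge> 0 \<Longrightarrow> sobolev_bounded_by m p M F \<Longrightarrow> sobolev_bounded_by m p (C * M) (\<lambda>z. F (\<phi> z))"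
    by auto
  define K where "K = max (max 1 (1 / c)) (4 ^ m * (D * C))"
  have K: "K \<ge> max 1 (1 / c)" "K \<ge> 4 ^ m * (D * C)" "K \<ge> 0" by (auto simp: K_def)
  have "sobolev_bounded_by (Suc m) p (K * M) (\<lambda>z. F (\<phi> z))" if M: "M \<ge> 0" and F: "sobolev_bounded_by (Suc m) p M F" for F M
  proof -
    have F0: "hardy_bounded_by p M F" and F1: "sobolev_bounded_by m p M (deriv F)"
      using F by (auto simp: sobolev_bounded_by_Suc)
    have "hardy_bounded_by p (K * M) (\<lambda>z. F (\<phi> z))"
      by (rule hardy_bounded_by_mono[OF hardy_bounded_by_compose[OF F0 p M hol self c low]])
         (use K M in \<open>auto intro!: mult_right_mono\<close>)
    moreover have "sobolev_bounded_by m p (K * M) (\<lambda>z. deriv \<phi> z * deriv F (\<phi> z))"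
    proof (rule sobolev_bounded_by_mono)
      show "sobolev_bounded_by m p (4 ^ m * (D * (C * M))) (\<lambda>z. deriv \<phi> z * deriv F (\<phi> z))"
        using D C(1) C(2)[OF M F1] M Suc.prems
        by (intro sobolev_bounded_by_mult_bounded p sobolev_bounded_by_le[OF D(1)]) auto
      show "4 ^ m * (D * (C * M)) \<le> K * M" using mult_right_mono[OF K(2) M] by (simp add: mult.assoc)
    qed (use D C M in auto)
    moreover have "deriv (\<lambda>z. F (\<phi> z)) z = deriv \<phi> z * deriv F (\<phi> z)" if z: "z \<in> upper_half_plane" for z
    proof -
      have "\<phi> z \<in> upper_half_plane" using self z by auto
      then show ?thesis
        using deriv_chain[of \<phi> z F] differentiable_upper_half_plane[OF hol z]
          differentiable_upper_half_plane[OF sobolev_bounded_byD(2)[OF F]]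
        by (simp add: o_def mult.commute)
    qed
    ultimately show ?thesis
      using sobolev_bounded_by_cong[of "deriv (\<lambda>z. F (\<phi> z))" "\<lambda>z. deriv \<phi> z * deriv F (\<phi> z)" m p "K * M"]
      by (simp add: sobolev_bounded_by_Suc)
  qed
  then show ?case using K(3) by blast
qed

lemma hardy_sobolev_norm_nonneg:
  "F \<in> hardy_sobolev_space m p \<Longrightarrow> hardy_sobolev_norm m p F \<ge> 0"
  by (auto simp: hardy_sobolev_norm_def hardy_sobolev_space_def intro!: sum_nonneg hardy_norm_nonneg)

lemma sobolev_bounded_by_hardy_sobolev_norm:
  assumes F: "F \<in> hardy_sobolev_space m p" and p: "1 \<le> p"
  shows "sobolev_bounded_by m p (hardy_sobolev_norm m p F) F"
  unfolding sobolev_bounded_by_def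
proof (intro allI impI)
  fix k assume k: "k \<le> m"
  let ?a = "\<lambda>k. hardy_norm p ((deriv ^^ k) F)"
  have mem: "(deriv ^^ j) F \<in> hardy_space p" if "j \<le> m" for j
    using F that by (simp add: hardy_sobolev_space_def)
  then have a0: "?a j \<ge> 0" if "j \<le> m" for j using that by (simp add: hardy_norm_nonneg)
  have "?a k \<le> hardy_sobolev_norm m p F"
  proof (cases "p = \<infinity>")
    case True
    then show ?thesis using a0 k by (auto simp: hardy_sobolev_norm_def intro!: member_le_sum)
  next
    case False
    define q where "q = enn2real p"
    have q: "q \<ge> 1" unfolding q_def by (rule enn2real_ge_1[OF p False])
    have "?a k powr q \<le> (\<Sum>j\<le>m. ?a j powr q)" using k by (intro member_le_sum) auto
    then have "(?a k powr q) powr (1 / q) \<le> (\<Sum>j\<le>m. ?a j powr q) powr (1 / q)"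
      using q by (intro powr_mono2) auto
    then show ?thesis using False q a0[OF k] by (simp add: hardy_sobolev_norm_def q_def powr_powr)
  qed
  then show "hardy_bounded_by p (hardy_sobolev_norm m p F) ((deriv ^^ k) F)"
    by (rule hardy_bounded_by_mono[OF hardy_bounded_by_hardy_norm[OF mem[OF k] p] a0[OF k]])
qed

lemma sobolev_bounded_by_imp_hardy_sobolev:
  assumes F: "sobolev_bounded_by m p M F" and p: "1 \<le> p" and M: "M \<ge> 0"
  shows "F \<in> hardy_sobolev_space m p" and "hardy_sobolev_norm m p F \<le> real (Suc m) * M"
proof -
  have hb: "(deriv ^^ k) F \<in> hardy_space p" "hardy_norm p ((deriv ^^ k) F) \<le> M" if "k \<le> m" for k
    using hardy_bounded_byD[OF _ p M] F that by (auto simp: sobolev_bounded_by_def)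
  show "F \<in> hardy_sobolev_space m p"
    using hb(1) sobolev_bounded_byD(2)[OF F] by (simp add: hardy_sobolev_space_def)
  show "hardy_sobolev_norm m p F \<le> real (Suc m) * M"
  proof (cases "p = \<infinity>")
    case True
    then show ?thesis
      using sum_bounded_above[of "{..m}" "\<lambda>k. hardy_norm p ((deriv ^^ k) F)" M] hb(2)
      by (simp add: hardy_sobolev_norm_def)
  next
    case False
    define q where "q = enn2real p"
    have q: "q \<ge> 1" unfolding q_def by (rule enn2real_ge_1[OF p False])
    have "hardy_norm p ((deriv ^^ k) F) powr q \<le> M powr q" if "k \<le> m" for k
      using hb[OF that] q by (intro powr_mono2 hardy_norm_nonneg) auto
    then have "(\<Sum>k\<le>m. hardy_norm p ((deriv ^^ k) F) powr q) \<le> real (Suc m) * M powr q"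
      using sum_bounded_above[of "{..m}" "\<lambda>k. hardy_norm p ((deriv ^^ k) F) powr q" "M powr q"] by simp
    also have "\<dots> \<le> real (Suc m) powr q * M powr q"
    proof (rule mult_right_mono)
      have "real (Suc m) powr 1 \<le> real (Suc m) powr q" using q by (intro powr_mono) auto
      then show "real (Suc m) \<le> real (Suc m) powr q" by simp
    qed auto
    also have "\<dots> = (real (Suc m) * M) powr q" using M by (simp add: powr_mult)
    finally have "hardy_sobolev_norm m p F \<le> ((real (Suc m) * M) powr q) powr (1 / q)"
      using False q by (auto simp: hardy_sobolev_norm_def q_def intro!: powr_mono2 sum_nonneg)
    then show ?thesis using q M by (simp add: powr_powr)
  qed
qed

theorem theorem5p7:
  fixes n :: nat and p :: ennreal and \<psi> \<phi> :: "complex \<Rightarrow> complex"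
  assumes "n \<ge> 1" and "1 \<le> p"
    and "\<psi> \<in> hardy_sobolev_space n \<infinity> \<or> \<psi> \<in> hardy_sobolev_space n p"
    and "\<phi> holomorphic_on upper_half_plane"
    and "\<phi> ` upper_half_plane \<subseteq> upper_half_plane"
    and "deriv \<phi> \<in> hardy_sobolev_space (n - 1) \<infinity>"
    and "\<exists>c>0. \<forall>z\<in>upper_half_plane. \<forall>w\<in>upper_half_plane. c \<le> A_fun \<phi> z w"
  shows "bounded_operator_on_hardy_sobolev n p (weighted_composition \<psi> \<phi>)"
proof -
  note p = \<open>1 \<le> p\<close> and hol = assms(4) and self = assms(5)
  obtain c where c: "c > 0" and A: "\<And>z w. z \<in> upper_half_plane \<Longrightarrow> w \<in> upper_half_plane \<Longrightarrow> c \<le> A_fun \<phi> z w"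
    using assms(7) by blast
  \<comment> \<open>On the diagonal \<open>A_fun\<close> is the modulus of the derivative.\<close>
  have low: "c * Im z \<le> Im (\<phi> z)" if z: "z \<in> upper_half_plane" for z
  proof -
    have "c \<le> cmod (deriv \<phi> z)"
      using A[OF z z] by (simp add: A_fun_def complex_eq[symmetric])
    then have "c * Im z \<le> cmod (deriv \<phi> z) * Im z"
      using z by (intro mult_right_mono) (auto simp: upper_half_plane_def)
    also have "\<dots> \<le> Im (\<phi> z)" by (rule Schwarz_Pick_half_plane[OF hol self z])
    finally show ?thesis .
  qed
  have D: "sobolev_bounded_by (n - 1) \<infinity> (hardy_sobolev_norm (n - 1) \<infinity> (deriv \<phi>)) (deriv \<phi>)"
    using assms(6) by (intro sobolev_bounded_by_hardy_sobolev_norm) auto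
  obtain C where C: "C \<ge> 0"
    "\<And>F M. M \<ge> 0 \<Longrightarrow> sobolev_bounded_by n p M F \<Longrightarrow> sobolev_bounded_by n p (C * M) (\<lambda>z. F (\<phi> z))"
    using sobolev_bounded_by_compose[OF p hol self c low D hardy_sobolev_norm_nonneg[OF assms(6)] order_refl] by blast
  obtain E where E: "E \<ge> 0"
    "\<And>G M. M \<ge> 0 \<Longrightarrow> sobolev_bounded_by n p M G \<Longrightarrow> sobolev_bounded_by n p (E * M) (\<lambda>z. \<psi> z * G z)"
    using assms(3)
  proof
    assume \<psi>: "\<psi> \<in> hardy_sobolev_space n \<infinity>"
    let ?N = "hardy_sobolev_norm n \<infinity> \<psi>"
    have N: "?N \<ge> 0" by (rule hardy_sobolev_norm_nonneg[OF \<psi>])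
    have "sobolev_bounded_by n \<infinity> ?N \<psi>" by (rule sobolev_bounded_by_hardy_sobolev_norm[OF \<psi>]) simp
    from sobolev_bounded_by_mult_bounded[OF this _ p N] N show thesis
      by (intro that[of "4 ^ n * ?N"]) (auto simp: mult.assoc)
  next
    assume \<psi>: "\<psi> \<in> hardy_sobolev_space n p"
    let ?N = "hardy_sobolev_norm n p \<psi>"
    have N: "?N \<ge> 0" by (rule hardy_sobolev_norm_nonneg[OF \<psi>])
    obtain m where m: "n = Suc m" using \<open>n \<ge> 1\<close> by (cases n) auto
    have "sobolev_bounded_by (Suc m) p ?N \<psi>"
      using sobolev_bounded_by_hardy_sobolev_norm[OF \<psi> p] by (simp add: m)
    from sobolev_bounded_by_mult[OF this _ p N] N show thesis
      by (intro that[of "4 ^ (m + 2) * ?N"]) (auto simp: mult.assoc m simp del: power_Suc)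
  qed
  have T: "sobolev_bounded_by n p (E * (C * hardy_sobolev_norm n p F)) (weighted_composition \<psi> \<phi> F)"
    "0 \<le> E * (C * hardy_sobolev_norm n p F)"
    if F: "F \<in> hardy_sobolev_space n p" for F
    using E C sobolev_bounded_by_hardy_sobolev_norm[OF F p] hardy_sobolev_norm_nonneg[OF F]
    by (simp_all add: weighted_composition_def)
  have "weighted_composition \<psi> \<phi> F \<in> hardy_sobolev_space n p" if "F \<in> hardy_sobolev_space n p" for F
    by (rule sobolev_bounded_by_imp_hardy_sobolev(1)[OF T(1)[OF that] p T(2)[OF that]])
  moreover have "hardy_sobolev_norm n p (weighted_composition \<psi> \<phi> F) \<le> (real (Suc n) * (E * C)) * hardy_sobolev_norm n p F"
    if "F \<in> hardy_sobolev_space n p" for F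
    using sobolev_bounded_by_imp_hardy_sobolev(2)[OF T(1)[OF that] p T(2)[OF that]] by (simp add: mult.assoc)
  moreover have "weighted_composition \<psi> \<phi> (\<lambda>u. a * F u + b * G u) z
      = a * weighted_composition \<psi> \<phi> F z + b * weighted_composition \<psi> \<phi> G z" for F G a b z
    by (simp add: weighted_composition_def algebra_simps)
  ultimately show ?thesis
    unfolding bounded_operator_on_hardy_sobolev_def by blast
qed

end
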